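(* Let $V \in L^1_{\mathrm{loc}}(\mathbb{R})$ be an even real-valued potential, bounded from below in the sense that $\operatorname{ess\,inf}_{x\in\mathbb{R}} V(x) > -\infty$, and such that $V(x) \to \infty$ as $|x| \to \infty$. Let $H_V = -\frac{1}{4\pi^2}\frac{d^2}{dx^2} + V(x)$, and let $\{w_n\}_{n\geq 0}$ be an orthogonal basis of $L^2(\mathbb{R})$ consisting of real-valued eigenfunctions, $H_V(w_n) = \lambda_n w_n$, where $\lambda_n \to \infty$ as $n \to \infty$ (the sequence $\{\lambda_n\}$ need not be monotone). Assume that for each $n$: (i) the function $w_n$ is even if $n$ is even, and odd if $n$ is odd; (ii) the sequences $\{\sqrt{\lambda_{2n}}\,x\}_n$ and $\{\sqrt{\lambda_{2n+1}}\,x\}_n$ are equidistributed modulo $1$, for any $x \in \mathbb{R}\setminus\{0\}$; (iii) $\operatorname{sgn}(w_{2n}(0)) = \operatorname{sgn}(w_{2n+1}'(0)) = (-1)^n$. Then the asymptotic $$w_n(x) = (1 + o_n(1)) \left(w_n(0)^2 + \frac{w_n'(0)^2}{4\pi^2\lambda_n}\right)^{1/2} \cos\left(2\pi\left(\sqrt{\lambda_n}\,x - \tfrac{n}{4}\right)\right)$$ holds uniformly on compact subsets of the real line. If $x, y$ are distinct real numbers such that $\frac{x}{y} = \frac{p}{q}$ for some nonzero coprime integers $p, q$, then the sign correlation limit $$\ell_{\{w_n\}}(x,y) := \lim_{N\to\infty} \frac{1}{N} \#\{0 \leq n < N : \operatorname{sgn}(w_n(x)) = \operatorname{sgn}(w_n(y))\}$$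 is given by $$\ell_{\{w_n\}}(x,y) = \begin{cases} \frac12 + \frac{1}{2pq} & \text{if } p \equiv q \equiv 1 \bmod 4, \text{ or } p \equiv q \equiv 3 \bmod 4, \\ \frac12 & \text{otherwise.} \end{cases}$$ If $\frac{x}{y}$ is irrational, then $\ell_{\{w_n\}}(x,y) = \frac12$.
   Context: A sequence $\{a_n\}_{n\geq 0} \subseteq [0,1]$ is equidistributed in $[0,1]$ if for any subinterval $[c,d] \subseteq [0,1]$ one has $\lim_{N\to\infty} \frac1N \#\{0 \leq n < N : a_n \in [c,d]\} = d - c$. A sequence $\{a_n\} \subseteq \mathbb{R}$ is equidistributed modulo $1$ if the sequence of fractional parts $a_n - \lfloor a_n \rfloor$ is equidistributed in $[0,1]$. The symbol $o_n(1)$ denotes a quantity tending to $0$ as $n \to \infty$. A prime denotes differentiation with respect to $x$. Under the stated assumptions on $V$, the Schrödinger operator $H_V$ on $L^2(\mathbb{R})$ has compact resolvent, hence purely discrete spectrum and a complete set of eigenfunctions. Since $\lambda_n\to\infty$, one has $\lambda_n>0$ for all large $n$, which is all that matters for the expressions involving $\sqrt{\lambda_n}$.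
   Formalization: The factor 1+o_n(1) on the cosine is replaced by an error relative to the amplitude: w_n = A_n(cos(...)+o_n(1)) uniformly on compacts, for large n; as written, w_n would vanish at every zero of the cosine, which fails for V = x² and Hermite functions. *)

theory Defs
  imports
    "HOL-Analysis.Analysis"
    "HOL-Probability.Essential_Supremum"
    "HOL-Number_Theory.Cong"
begin

section \<open>Functions on the line\<close>

definition ess_inf :: "(real \<Rightarrow> real) \<Rightarrow> ereal" where
  "ess_inf f = - esssup lebesgue (\<lambda>x. - ereal (f x))"

definition L1_loc :: "(real \<Rightarrow> 'a::euclidean_space) set" where
  "L1_loc = {f. \<forall>K. compact K \<longrightarrow> f absolutely_integrable_on K}"

text \<open>Elements of \<open>L\<^sup>2\<close> are represented by functions; they are not identified when equal
  almost everywhere.\<close>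

definition L2 :: "(real \<Rightarrow> complex) set" where
  "L2 = {f \<in> borel_measurable lebesgue. integrable lebesgue (\<lambda>x. (cmod (f x))\<^sup>2)}"

definition L2_inner :: "(real \<Rightarrow> complex) \<Rightarrow> (real \<Rightarrow> complex) \<Rightarrow> complex" where
  "L2_inner f g = (LINT x|lebesgue. f x * cnj (g x))"

definition L2_norm :: "(real \<Rightarrow> complex) \<Rightarrow> real" where
  "L2_norm f = sqrt (LINT x|lebesgue. (cmod (f x))\<^sup>2)"

text \<open>A sequence of nonzero, pairwise orthogonal vectors whose linear span is dense.\<close>

definition L2_orthogonal_basis :: "(nat \<Rightarrow> real \<Rightarrow> complex) \<Rightarrow> bool" where
  "L2_orthogonal_basis e \<longleftrightarrow>
     (\<forall>n. e n \<in> L2 \<and> L2_norm (e n) \<noteq> 0) \<and>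
     (\<forall>m n. m \<noteq> n \<longrightarrow> L2_inner (e m) (e n) = 0) \<and>
     (\<forall>f\<in>L2. \<forall>\<epsilon>>0. \<exists>N c. L2_norm (\<lambda>x. f x - (\<Sum>n<N. c n * e n x)) < \<epsilon>)"


section \<open>The Schroedinger operator\<close>

text \<open>\<open>AC_loc_deriv f g\<close>: \<open>f\<close> is locally absolutely continuous with derivative \<open>g\<close> (almost
  everywhere), in the form: \<open>f\<close> is an indefinite integral of the locally integrable \<open>g\<close>.\<close>

definition AC_loc_deriv :: "(real \<Rightarrow> complex) \<Rightarrow> (real \<Rightarrow> complex) \<Rightarrow> bool" where
  "AC_loc_deriv f g \<longleftrightarrow>
     g \<in> L1_loc \<and> (\<forall>a b. a \<le> b \<longrightarrow> f b - f a = integral {a..b} g)"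

text \<open>The graph of \<open>H\<^sub>V\<close>: \<open>schroedinger V f u\<close> says that \<open>f\<close> lies in the domain and
  \<open>H\<^sub>V f = u\<close>. The domain is the maximal one: \<open>f\<close> and \<open>f'\<close> locally absolutely continuous,
  with \<open>f\<close> and \<open>-f''/(4\<pi>\<^sup>2) + V f\<close> in \<open>L\<^sup>2\<close>. For \<open>V\<close> locally integrable and bounded below
  both endpoints are in the limit point case, so this is the self-adjoint realisation. The
  function \<open>f\<close> is the continuously differentiable representative of its class, so
  its values and those of \<open>f'\<close> at points are meaningful.\<close>

definition schroedinger :: "(real \<Rightarrow> real) \<Rightarrow> (real \<Rightarrow> complex) \<Rightarrow> (real \<Rightarrow> complex) \<Rightarrow> bool" where
  "schroedinger V f u \<longleftrightarrow> f \<in> L2 \<and> u \<in> L2 \<and>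
     (\<exists>f' f''. AC_loc_deriv f f' \<and> AC_loc_deriv f' f'' \<and>
        (AE x in lebesgue. u x = - f'' x / (4 * of_real (pi\<^sup>2)) + of_real (V x) * f x))"

definition schroedinger_eigenfunction ::
    "(real \<Rightarrow> real) \<Rightarrow> real \<Rightarrow> (real \<Rightarrow> complex) \<Rightarrow> bool" where
  "schroedinger_eigenfunction V \<mu> f \<longleftrightarrow>
     L2_norm f \<noteq> 0 \<and> schroedinger V f (\<lambda>x. of_real \<mu> * f x)"


section \<open>Equidistribution\<close>

definition equidistributed :: "(nat \<Rightarrow> real) \<Rightarrow> bool" where
  "equidistributed a \<longleftrightarrow> (\<forall>n. a n \<in> {0..1}) \<and>
     (\<forall>c d. 0 \<le> c \<and> c \<le> d \<and> d \<le> 1 \<longrightarrow>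
        (\<lambda>N. real (card {n. n < N \<and> a n \<in> {c..d}}) / real N) \<longlonglongrightarrow> d - c)"

definition equidistributed_mod1 :: "(nat \<Rightarrow> real) \<Rightarrow> bool" where
  "equidistributed_mod1 a \<longleftrightarrow> equidistributed (\<lambda>n. frac (a n))"


section \<open>Sign correlation\<close>

definition has_sign_correlation :: "(nat \<Rightarrow> real \<Rightarrow> real) \<Rightarrow> real \<Rightarrow> real \<Rightarrow> real \<Rightarrow> bool" where
  "has_sign_correlation w x y l \<longleftrightarrow>
     (\<lambda>N. real (card {n. n < N \<and> sgn (w n x) = sgn (w n y)}) / real N) \<longlonglongrightarrow> l"

text \<open>The asymptotic amplitude \<open>(w(0)\<^sup>2 + w'(0)\<^sup>2 / (4\<pi>\<^sup>2\<mu>))\<^bsup>1/2\<^esup>\<close>, for \<open>\<mu> > 0\<close>.\<close>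

definition amplitude :: "(real \<Rightarrow> real) \<Rightarrow> real \<Rightarrow> real" where
  "amplitude f \<mu> = sqrt ((f 0)\<^sup>2 + (deriv f 0)\<^sup>2 / (4 * pi\<^sup>2 * \<mu>))"

text \<open>The asymptotic \<open>w\<^sub>n(x) = (1 + o\<^sub>n(1)) A\<^sub>n cos (2\<pi>(\<surd>\<mu>\<^sub>n x - n/4))\<close>, uniformly on compact
  sets. The error is measured relative to the amplitude \<open>A\<^sub>n\<close>:
  \<open>w\<^sub>n(x) = A\<^sub>n (cos (2\<pi>(\<surd>\<mu>\<^sub>n x - n/4)) + o\<^sub>n(1))\<close>. A factor \<open>1 + o\<^sub>n(1)\<close> multiplying the cosine
  itself would force \<open>w\<^sub>n\<close> to vanish exactly at the zeros of the cosine, which fails already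
  for \<open>V(x) = x\<^sup>2\<close>. As \<open>\<mu>\<^sub>n\<close> may be nonpositive for finitely many \<open>n\<close>, the identity is only
  required for large \<open>n\<close>.\<close>

definition cosine_asymptotic :: "(nat \<Rightarrow> real \<Rightarrow> real) \<Rightarrow> (nat \<Rightarrow> real) \<Rightarrow> bool" where
  "cosine_asymptotic w \<mu> \<longleftrightarrow>
     (\<exists>r :: nat \<Rightarrow> real \<Rightarrow> real.
        (\<forall>K. compact K \<longrightarrow> uniform_limit K r (\<lambda>x. 0) sequentially) \<and>
        (\<forall>\<^sub>F n in sequentially. \<forall>x. w n x =
           amplitude (w n) (\<mu> n) * (cos (2 * pi * (sqrt (\<mu> n) * x - real n / 4)) + r n x)))"

end

theory Submission
  imports Defs "HOL-Probability.Weak_Convergence" "HOL-Probability.Probability_Mass_Function"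
    "HOL-Real_Asymp.Real_Asymp"
begin

text \<open>
  Variation of parameters turns the eigenvalue equation into a Volterra equation whose kernel is
  \<open>O(1/\<surd>\<mu>)\<close> on compact sets, which gives the cosine asymptotic. The phase
  \<open>n/4\<close> makes all eigenfunctions of one parity look, up to a common sign, like
  \<open>cos (2\<pi>(\<surd>\<mu> x - \<theta>))\<close> with \<open>\<theta> = 0\<close> (even \<open>n\<close>) or \<open>\<theta> = 1/4\<close> (odd \<open>n\<close>). So sign
  correlations are means of products of square waves. Equidistribution allows each
  square wave to be replaced, in mean square, by a partial sum of its Fourier series, and the mean
  of a product of two cosines vanishes unless their frequencies \<open>(2k+1)x\<close> and \<open>(2l+1)y\<close> agree up to
  sign. This never happens if \<open>x/y\<close> is irrational; if \<open>x/y = \<plusminus>p/q\<close> with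
  \<open>p, q\<close> odd it happens exactly for \<open>2k+1 = q(2s+1)\<close>, \<open>2l+1 = p(2s+1)\<close>, and the sum over \<open>s\<close> is a
  multiple of \<open>\<Sum> 1/(2s+1)\<^sup>2 = \<pi>\<^sup>2/8\<close>.
\<close>

section \<open>Means of equidistributed sequences\<close>

text \<open>Two effects rule out pointwise estimates. The square wave jumps, so no partial sum of
  its Fourier series is uniformly close to it. The remainder in the cosine asymptotic is small
  relative to the amplitude, not to the cosine, so it can change the sign wherever the cosine is
  small. Both errors are controlled only in the mean over \<open>n\<close>. Even and odd indices are
  kept apart because equidistribution is assumed for each class, and because their limits
  \<open>E\<close> and \<open>E'\<close> can differ: for odd p and q a resonant pair carries a phase
  factor that is 1 for \<theta> = 0 and the sign of parity (q - p)/2 for \<theta> = 1/4. The two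
  classes therefore reinforce each other when 4 divides q - p and cancel otherwise, which is the
  origin of the congruence condition. Dividing by the amplitude makes the remainder bound depend on
  the potential, the compact set and the eigenvalue only. The sign hypotheses allow this division,
  since they force a nonzero value or slope at 0.\<close>

definition cesaro_lim :: "(nat \<Rightarrow> real) \<Rightarrow> real \<Rightarrow> bool" where
  "cesaro_lim g c \<longleftrightarrow> (\<lambda>N. (\<Sum>n<N. g n) / real N) \<longlonglongrightarrow> c"

lemma cesaro_lim_const: "cesaro_lim (\<lambda>_. c) c"
proof -
  have "\<forall>\<^sub>F N in sequentially. c = (\<Sum>n<N. c) / real N"
    using eventually_gt_at_top[of 0] by eventually_elim simp
  then show ?thesis
    unfolding cesaro_lim_def by (rule Lim_transform_eventually[OF tendsto_const])
qed

lemma cesaro_lim_add: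
  "cesaro_lim f a \<Longrightarrow> cesaro_lim g b \<Longrightarrow> cesaro_lim (\<lambda>n. f n + g n) (a + b)"
  unfolding cesaro_lim_def sum.distrib add_divide_distrib by (rule tendsto_add)

lemma cesaro_lim_cmult: "cesaro_lim f a \<Longrightarrow> cesaro_lim (\<lambda>n. c * f n) (c * a)"
  unfolding cesaro_lim_def sum_distrib_left[symmetric] times_divide_eq_right[symmetric]
  by (rule tendsto_mult_left)

lemma cesaro_lim_diff:
  "cesaro_lim f a \<Longrightarrow> cesaro_lim g b \<Longrightarrow> cesaro_lim (\<lambda>n. f n - g n) (a - b)"
  using cesaro_lim_add[of f a "\<lambda>n. -1 * g n" "-1 * b"] cesaro_lim_cmult[of g b "-1"] by simp

lemma cesaro_lim_sum:
  "(\<And>i. i \<in> I \<Longrightarrow> cesaro_lim (f i) (a i)) \<Longrightarrow>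
    cesaro_lim (\<lambda>n. \<Sum>i\<in>I. f i n) (\<Sum>i\<in>I. a i)"
proof (induction I rule: infinite_finite_induct)
  case (insert x F)
  then show ?case by (simp add: cesaro_lim_add)
qed (simp_all add: cesaro_lim_const)

lemma cesaro_lim_eventually_0:
  assumes "\<forall>\<^sub>F n in sequentially. h n = 0"
  shows "cesaro_lim h 0"
proof -
  obtain m where m: "\<And>n. n \<ge> m \<Longrightarrow> h n = 0"
    using assms by (auto simp: eventually_sequentially)
  have "(\<lambda>N. (\<Sum>n<m. h n) / real N) \<longlonglongrightarrow> 0"
    by (intro tendsto_divide_0[OF tendsto_const] filterlim_at_top_imp_at_infinity
        filterlim_real_sequentially)
  moreover have "\<forall>\<^sub>F N in sequentially. (\<Sum>n<m. h n) / real N = (\<Sum>n<N. h n) / real N"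
    using eventually_ge_at_top[of m]
  proof eventually_elim
    case (elim N)
    have "(\<Sum>n<m. h n) = (\<Sum>n<N. h n)"
      by (rule sum.mono_neutral_left) (use elim m in auto)
    then show ?case by simp
  qed
  ultimately show ?thesis
    unfolding cesaro_lim_def by (rule Lim_transform_eventually)
qed

text \<open>Finitely many terms do not affect a mean. This absorbs the indices at which the
  asymptotic is not yet available.\<close>

lemma cesaro_lim_cong:
  assumes "cesaro_lim f c" and "\<forall>\<^sub>F n in sequentially. f n = g n"
  shows "cesaro_lim g c"
proof -
  have "cesaro_lim (\<lambda>n. g n - f n) 0"
    by (rule cesaro_lim_eventually_0) (use assms(2) in eventually_elim, simp)
  from cesaro_lim_add[OF assms(1) this] show ?thesis by simp
qed

text \<open>Closure under errors that are small in the mean: \<open>d\<close> may be large at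
  individual indices, as near a jump of the square wave or a zero of the cosine, provided that its
  mean \<open>D\<close> is at most \<open>e\<close>.\<close>

lemma cesaro_lim_approx:
  assumes "\<And>e. e > 0 \<Longrightarrow> \<exists>f d c' D. cesaro_lim f c' \<and> cesaro_lim d D \<and>
    (\<forall>\<^sub>F n in sequentially. \<bar>g n - f n\<bar> \<le> d n) \<and> \<bar>c' - c\<bar> \<le> e \<and> D \<le> e"
  shows "cesaro_lim g c"
  unfolding cesaro_lim_def
proof (rule LIMSEQ_I)
  fix r :: real assume "r > 0"
  then obtain f d c' D where f: "cesaro_lim f c'" and d: "cesaro_lim d D"
    and fd: "\<forall>\<^sub>F n in sequentially. \<bar>g n - f n\<bar> \<le> d n" 
    and e: "\<bar>c' - c\<bar> \<le> r / 8" "D \<le> r / 8"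
    using assms[of "r / 8"] by auto
  \<comment> \<open>Domination by \<open>d\<close> holds only for large \<open>n\<close>. The
    maximum dominates for every \<open>n\<close> and differs from \<open>d\<close> at finitely many
    indices, so its mean is still \<open>D\<close>.\<close>
  define d' where "d' n = max (d n) \<bar>g n - f n\<bar>" for n
  have "cesaro_lim d' D"
    by (rule cesaro_lim_cong[OF d]) (use fd in eventually_elim, simp add: d'_def)
  then have "\<forall>\<^sub>F N in sequentially. \<bar>(\<Sum>n<N. d' n) / real N - D\<bar> < r / 8"
    using \<open>r > 0\<close> unfolding cesaro_lim_def tendsto_iff dist_real_def by (simp del: less_divide_eq_numeral1)
  moreover have "\<forall>\<^sub>F N in sequentially. \<bar>(\<Sum>n<N. f n) / real N - c'\<bar> < r / 8"
    using \<open>r > 0\<close> f unfolding cesaro_lim_def tendsto_iff dist_real_def by (simp del: less_divide_eq_numeral1)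
  ultimately have "\<forall>\<^sub>F N in sequentially. norm ((\<Sum>n<N. g n) / real N - c) < r"
  proof eventually_elim
    case (elim N)
    have "\<bar>(\<Sum>n<N. g n) / real N - (\<Sum>n<N. f n) / real N\<bar> = \<bar>\<Sum>n<N. g n - f n\<bar> / real N"
      by (simp add: sum_subtractf diff_divide_distrib abs_divide flip: diff_divide_distrib)
    also have "\<dots> \<le> (\<Sum>n<N. \<bar>g n - f n\<bar>) / real N"
      by (intro divide_right_mono sum_abs) simp
    also have "\<dots> \<le> (\<Sum>n<N. d' n) / real N"
      by (intro divide_right_mono sum_mono) (auto simp: d'_def)
    finally show ?case using elim e \<open>r > 0\<close> unfolding real_norm_def by linarith
  qed
  then show "\<exists>no. \<forall>N\<ge>no. norm ((\<Sum>n<N. g n) / real N - c) < r"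
    by (simp add: eventually_sequentially)
qed

lemma cesaro_lim_even_odd:
  assumes "cesaro_lim (\<lambda>m. g (2 * m)) a" and "cesaro_lim (\<lambda>m. g (2 * m + 1)) b"
  shows "cesaro_lim g ((a + b) / 2)"
proof -
  define E where "E M = (\<Sum>m<M. g (2 * m)) / real M" for M
  define F where "F M = (\<Sum>m<M. g (2 * m + 1)) / real M" for M
  \<comment> \<open>Below \<open>N\<close> there are \<open>(N + 1) div 2\<close> even and
    \<open>N div 2\<close> odd indices. Both counts are asymptotic to \<open>N / 2\<close>, hence
    the equal weights.\<close>
  have split: "(\<Sum>n<N. g n) = (\<Sum>m<(N + 1) div 2. g (2 * m)) + (\<Sum>m<N div 2. g (2 * m + 1))" for N
  proof (induction N)
    case (Suc N)
    show ?case
    proof (cases "even N")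
      case True
      then obtain k where "N = 2 * k" by blast
      then show ?thesis using Suc by simp
    next
      case False
      then obtain k where "N = 2 * k + 1" by (elim oddE)
      then show ?thesis using Suc by simp
    qed
  qed simp
  have lims: "filterlim (\<lambda>N::nat. (N + 1) div 2) at_top sequentially"
             "filterlim (\<lambda>N::nat. N div 2) at_top sequentially"
    by (auto simp: filterlim_at_top eventually_sequentially) 
      (metis Suc_leD div_le_mono le_Suc_eq div_mult_self1_is_m mult.commute zero_less_numeral nat_le_linear)+
  have h: "(\<lambda>N. real ((N + 1) div 2) / real N) \<longlonglongrightarrow> 1 / 2"
          "(\<lambda>N. real (N div 2) / real N) \<longlonglongrightarrow> 1 / 2"
  proof -
    have 1: "real N / 2 \<le> real ((N + 1) div 2)" "real ((N + 1) div 2) \<le> (real N + 1) / 2"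
      "(real N - 1) / 2 \<le> real (N div 2)" "real (N div 2) \<le> real N / 2" for N
      by (cases "even N"; auto elim!: evenE oddE)+
    have lim: "(\<lambda>N::nat. (real N / 2) / real N) \<longlonglongrightarrow> 1 / 2" "(\<lambda>N::nat. ((real N + 1) / 2) / real N) \<longlonglongrightarrow> 1 / 2"
       "(\<lambda>N::nat. ((real N - 1) / 2) / real N) \<longlonglongrightarrow> 1 / 2"
      by real_asymp+
    show "(\<lambda>N. real ((N + 1) div 2) / real N) \<longlonglongrightarrow> 1 / 2"
      by (rule tendsto_sandwich[OF _ _ lim(1,2)]) (intro always_eventually allI divide_right_mono 1; simp)+
    show "(\<lambda>N. real (N div 2) / real N) \<longlonglongrightarrow> 1 / 2"
      by (rule tendsto_sandwich[OF _ _ lim(3,1)]) (intro always_eventually allI divide_right_mono 1; simp)+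
  qed
  have "(\<lambda>N. real ((N + 1) div 2) / real N * E ((N + 1) div 2) + real (N div 2) / real N * F (N div 2))
      \<longlonglongrightarrow> 1 / 2 * a + 1 / 2 * b"
    using assms unfolding cesaro_lim_def E_def[symmetric] F_def[symmetric]
    by (intro tendsto_intros h filterlim_compose[OF _ lims(1)] filterlim_compose[OF _ lims(2)])
  \<comment> \<open>If one of the counts is 0, its sum is empty and the quotient by 0 is 0, so both
    sides agree for every \<open>N\<close>.\<close>
  also have "(\<lambda>N. real ((N + 1) div 2) / real N * E ((N + 1) div 2) + real (N div 2) / real N * F (N div 2))
     = (\<lambda>N. (\<Sum>n<N. g n) / real N)"
    unfolding E_def F_def split by (auto simp: fun_eq_iff add_divide_distrib)
  finally show ?thesis by (simp add: cesaro_lim_def add_divide_distrib)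
qed

text \<open>The averages are integrals against empirical measures. Equidistribution says that their
  distribution functions converge to that of the uniform law; weak convergence then extends to
  bounded functions that are continuous almost everywhere, a class that contains the square
  wave.\<close>

theorem equidistributed_cesaro_lim:
  fixes F :: "real \<Rightarrow> real"
  assumes a: "equidistributed a"
    and F[measurable]: "F \<in> borel_measurable borel" and bdd: "\<And>x. \<bar>F x\<bar> \<le> B"
    and cont: "{x. \<not> isCont F x} \<in> null_sets lborel"
  shows "cesaro_lim (\<lambda>n. F (a n)) (integral {0..1} F)"
proof -
  \<comment> \<open>The \<open>N + 1\<close> indices up to \<open>N\<close> form a nonempty set even
    for \<open>N = 0\<close>, so this is always a probability measure. The shift by one is undone in
    the last step.\<close>
  define \<nu> where "\<nu> N = distr (measure_pmf (pmf_of_set {..N})) borel a" for N :: nat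
  define M where "M = density lborel (indicator {0..1::real})"
  have "prob_space M"
    by (rule prob_spaceI) (simp add: M_def emeasure_density)
  then interpret M: real_distribution M
    by (simp add: real_distribution_def real_distribution_axioms_def M_def)
  have \<nu>: "real_distribution (\<nu> N)" for N
    unfolding \<nu>_def by (rule prob_space.real_distribution_distr) (auto intro: measure_pmf.prob_space_axioms)
  have \<nu>_cdf: "cdf (\<nu> N) x = real (card {n. n < Suc N \<and> a n \<le> x}) / real (Suc N)" for N x
  proof -
    have "cdf (\<nu> N) x = measure (measure_pmf (pmf_of_set {..N})) (a -` {..x})"
      unfolding cdf_def \<nu>_def by (subst measure_distr) auto
    also have "\<dots> = real (card ({..N} \<inter> a -` {..x})) / real (card {..N})"
      by (subst measure_pmf_of_set) auto
    also have "{..N} \<inter> a -` {..x} = {n. n < Suc N \<and> a n \<le> x}" by auto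
    finally show ?thesis by simp
  qed
  have M_cdf: "cdf M x = (if x < 0 then 0 else min x 1)" for x
  proof -
    have "cdf M x = measure lborel ({0..1} \<inter> {..x})"
      unfolding cdf_def M_def by (simp add: measure_def emeasure_density flip: indicator_inter_arith)
    also have "{0..1} \<inter> {..x} = {0..min x 1}" by auto
    finally show ?thesis by (auto simp: min_def)
  qed
  have a01: "0 \<le> a n" "a n \<le> 1" for n using a by (auto simp: equidistributed_def)
  have "(\<lambda>N. cdf (\<nu> N) x) \<longlonglongrightarrow> cdf M x" for x
  proof -
    consider "x < 0" | "0 \<le> x" "x \<le> 1" | "x > 1" by linarith
    then show ?thesis
    proof cases
      case 1
      then have "{n. n < Suc N \<and> a n \<le> x} = {}" for N using a01(1) by (auto simp: not_le intro: less_le_trans)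
      then show ?thesis using 1 unfolding \<nu>_cdf M_cdf by (simp only: card.empty) simp
    next
      case 2
      then have "(\<lambda>N. real (card {n. n < N \<and> a n \<in> {0..x}}) / real N) \<longlonglongrightarrow> x - 0"
        using a unfolding equidistributed_def by blast
      then have "(\<lambda>N. real (card {n. n < Suc N \<and> a n \<in> {0..x}}) / real (Suc N)) \<longlonglongrightarrow> x"
        by (subst (asm) filterlim_sequentially_Suc[symmetric]) simp
      then show ?thesis using 2 a01 by (simp add: \<nu>_cdf M_cdf)
    next
      case 3
      then have "{n. n < Suc N \<and> a n \<le> x} = {..<Suc N}" for N 
        using a01(2) by (auto intro: order.trans less_imp_le)
      then show ?thesis using 3 unfolding \<nu>_cdf M_cdf
        by (simp only: card_lessThan) (simp del: of_nat_Suc)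
    qed
  qed
  then have "weak_conv_m \<nu> M"
    by (simp add: weak_conv_m_def weak_conv_def)
  then have "(\<lambda>N. integral\<^sup>L (\<nu> N) F) \<longlonglongrightarrow> integral\<^sup>L M F"
  proof (rule weak_conv_imp_bdd_ae_continuous_conv[OF \<nu> M.real_distribution_axioms])
    have "absolutely_continuous lborel M"
      unfolding M_def by (rule absolutely_continuousI_density) simp
    then show "emeasure M {x. \<not> isCont F x} = 0"
      using cont by (auto simp: absolutely_continuous_def)
    show "norm (F x) \<le> B" for x using bdd by simp
  qed simp
  moreover have "integral\<^sup>L (\<nu> N) F = (\<Sum>n<Suc N. F (a n)) / real (Suc N)" for N
    unfolding \<nu>_def by (subst integral_distr) (auto simp: integral_pmf_of_set lessThan_Suc_atMost)
  moreover have "integral\<^sup>L M F = integral {0..1} F"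
  proof -
    have "set_integrable lborel {0..1} F"
      unfolding set_integrable_def
      by (rule integrableI_bounded_set[where A="{0..1}" and B=B]) (use bdd in \<open>auto simp: indicator_def\<close>)
    then have "(LBINT x:{0..1}. F x) = integral {0..1} F"
      by (rule set_borel_integral_eq_integral)
    moreover have "integral\<^sup>L M F = (LBINT x:{0..1}. F x)"
    proof -
      have "M = density lborel (\<lambda>x. ennreal (indicator {0..1::real} x))"
        unfolding M_def by (simp add: ennreal_indicator)
      then show ?thesis
        by (simp add: integral_density set_lebesgue_integral_def)
    qed
    ultimately show ?thesis by simp
  qed
  ultimately have "(\<lambda>N. (\<Sum>n<Suc N. F (a n)) / real (Suc N)) \<longlonglongrightarrow> integral {0..1} F" by simp
  then show ?thesis unfolding cesaro_lim_def
    by (subst filterlim_sequentially_Suc[symmetric])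
qed

section \<open>Square waves and their Fourier series\<close>

definition sqw :: "real \<Rightarrow> real" where
  "sqw t = sgn (cos (2 * pi * t))"

text \<open>The cosine coefficients of \<open>sqw\<close>, that is, twice the integral over one
  period. Even harmonics are absent because a shift by half a period reverses the sign of
  \<open>sqw\<close>.\<close>

definition sqw_coeff :: "nat \<Rightarrow> real" where
  "sqw_coeff k = 4 / pi * (-1) ^ k / real (2 * k + 1)"

definition sqw_sum :: "nat \<Rightarrow> real \<Rightarrow> real" where
  "sqw_sum M t = (\<Sum>k<M. sqw_coeff k * cos (2 * pi * real (2 * k + 1) * t))"

text \<open>The even denominators contribute one quarter of the full series, so pi^2/6 loses a
  quarter of itself.\<close>

lemma odd_inverse_squares_sums: "(\<lambda>k. 1 / (real (2 * k + 1))\<^sup>2) sums (pi\<^sup>2 / 8)"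
proof -
  let ?f = "\<lambda>n. 1 / (real n + 1)\<^sup>2"
  have split: "(\<Sum>k<M. 1 / (real (2 * k + 1))\<^sup>2) = (\<Sum>n<2 * M. ?f n) - (\<Sum>n<M. ?f n) / 4" for M
  proof (induction M)
    case (Suc M)
    have "1 / (real (2 * M + 1) + 1)\<^sup>2 = ?f M / 4"
      by (simp add: power2_eq_square field_simps)
    then show ?case using Suc by (simp add: add_divide_distrib add_ac)
  qed simp
  have lim: "(\<lambda>M. \<Sum>n<M. ?f n) \<longlonglongrightarrow> pi\<^sup>2 / 6"
    using inverse_squares_sums unfolding sums_def by (simp add: add_ac)
  have "(\<lambda>M. \<Sum>n<2 * M. ?f n) \<longlonglongrightarrow> pi\<^sup>2 / 6"
    by (rule filterlim_compose[OF lim]) (simp add: filterlim_subseq strict_mono_def)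
  then have "(\<lambda>M. (\<Sum>n<2 * M. ?f n) - (\<Sum>n<M. ?f n) / 4) \<longlonglongrightarrow> pi\<^sup>2 / 6 - pi\<^sup>2 / 6 / 4"
    by (intro tendsto_intros lim) auto
  then show ?thesis unfolding sums_def split by simp
qed

text \<open>Parseval's identity for the square wave, whose square has mean 1. It is read off from
  the value of the series over odd squares, so no completeness of the trigonometric system
  enters.\<close>

lemma sqw_coeff_square_sums: "(\<lambda>k. (sqw_coeff k)\<^sup>2 / 2) sums 1"
proof -
  have "(sqw_coeff k)\<^sup>2 / 2 = 8 / pi\<^sup>2 * (1 / (real (2 * k + 1))\<^sup>2)" for k
    unfolding sqw_coeff_def by (simp add: power_mult_distrib power_divide flip: power_mult)
  then show ?thesis
    using sums_mult[OF odd_inverse_squares_sums, of "8 / pi\<^sup>2"] by simp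
qed

lemma abs_sqw_le: "\<bar>sqw t\<bar> \<le> 1"
  by (simp add: sqw_def abs_sgn_eq)

text \<open>Reduces the error of a product to mean-square errors. Since \<open>u * u\<close> is at
  most 1, the square \<open>(u - u')\<^sup>2\<close> is bounded by
  \<open>1 - 2 * (u * u') + u' * u'\<close>, whose mean needs only the Fourier coefficients and the
  orthogonality of the harmonics.\<close>

lemma sqw_product_approx:
  fixes u v u' v' \<eta> :: real
  assumes "\<eta> > 0" "\<bar>u\<bar> \<le> 1" "\<bar>v\<bar> \<le> 1"
  shows "\<bar>u * v - u' * v'\<bar> \<le> \<eta> + (1 / (2 * \<eta>) + 1 / 2) *
    ((1 - 2 * (u * u') + u' * u') + (1 - 2 * (v * v') + v' * v'))"
proof -
  define x y where "x = \<bar>u - u'\<bar>" and "y = \<bar>v - v'\<bar>"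
  \<comment> \<open>A linear error has no direct mean-square bound; this trades it for a square at
    the price of \<open>\<eta> / 2\<close>, paid once for each factor.\<close>
  have sq: "t \<le> \<eta> / 2 + t\<^sup>2 / (2 * \<eta>)" for t
  proof -
    have "0 \<le> (t - \<eta>)\<^sup>2" by simp
    then show ?thesis using \<open>\<eta> > 0\<close> by (simp add: field_simps power2_eq_square)
  qed
  have xy: "x * y \<le> x\<^sup>2 / 2 + y\<^sup>2 / 2"
    using sum_squares_bound[of x y] by simp
  have u1: "\<bar>u'\<bar> \<le> 1 + x" using assms(2) by (simp add: x_def)
  have "\<bar>u * v - u' * v'\<bar> = \<bar>(u - u') * v + u' * (v - v')\<bar>" by (simp add: algebra_simps)
  also have "\<dots> \<le> x * \<bar>v\<bar> + \<bar>u'\<bar> * y"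
    unfolding x_def y_def abs_mult[symmetric] by (rule abs_triangle_ineq)
  also have "\<dots> \<le> x * 1 + (1 + x) * y"
    by (intro add_mono mult_mono u1 assms(3)) (auto simp: x_def y_def)
  also have "\<dots> \<le> \<eta> + (1 / (2 * \<eta>) + 1 / 2) * (x\<^sup>2 + y\<^sup>2)"
    using sq[of x] sq[of y] xy by (simp add: algebra_simps add_divide_distrib)
  also have "\<dots> \<le> \<eta> + (1 / (2 * \<eta>) + 1 / 2) *
    ((1 - 2 * (u * u') + u' * u') + (1 - 2 * (v * v') + v' * v'))"
  proof -
    have "u * u \<le> 1" "v * v \<le> 1" using assms(2,3) by (simp_all add: abs_le_square_iff[of _ 1, simplified] power2_eq_square)
    then show ?thesis using \<open>\<eta> > 0\<close>
      by (intro add_left_mono mult_left_mono) (auto simp: x_def y_def power2_eq_square algebra_simps)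
  qed
  finally show ?thesis .
qed

text \<open>The mean of \<open>(S - S\<^sub>m)\<^sup>2\<close>, for \<open>S\<close> the square wave and \<open>S\<^sub>m\<close> its partial sum, is at most
  \<open>1 - \<Sum>\<^bsub>k<m\<^esub> c\<^sub>k\<^sup>2/2\<close>, which tends to \<open>0\<close>.\<close>

lemma sqw_correlation:
  fixes a b :: "nat \<Rightarrow> real" and e :: "nat \<Rightarrow> nat \<Rightarrow> real"
  defines "c \<equiv> \<lambda>k t. cos (2 * pi * real (2 * k + 1) * t)"
  assumes sa: "\<And>k. cesaro_lim (\<lambda>n. sqw (a n) * c k (a n)) (sqw_coeff k / 2)"
    and sb: "\<And>k. cesaro_lim (\<lambda>n. sqw (b n) * c k (b n)) (sqw_coeff k / 2)"
    and aa: "\<And>k l. cesaro_lim (\<lambda>n. c k (a n) * c l (a n)) (if k = l then 1 / 2 else 0)"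
    and bb: "\<And>k l. cesaro_lim (\<lambda>n. c k (b n) * c l (b n)) (if k = l then 1 / 2 else 0)"
    and ab: "\<And>k l. cesaro_lim (\<lambda>n. c k (a n) * c l (b n)) (e k l)"
    and M: "filterlim M at_top sequentially" "filterlim M' at_top sequentially"
    and E: "(\<lambda>L. \<Sum>k<M L. \<Sum>l<M' L. sqw_coeff k * sqw_coeff l * e k l) \<longlonglongrightarrow> E"
  shows "cesaro_lim (\<lambda>n. sqw (a n) * sqw (b n)) E"
proof (rule cesaro_lim_approx)
  fix \<epsilon> :: real assume "\<epsilon> > 0"
  define \<eta> where "\<eta> = \<epsilon> / 2"
  have "\<eta> > 0" "\<eta> < \<epsilon>" using \<open>\<epsilon> > 0\<close> by (auto simp: \<eta>_def)
  define \<delta> where "\<delta> m = 1 - (\<Sum>k<m. (sqw_coeff k)\<^sup>2 / 2)" for m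
  have prod: "cesaro_lim (\<lambda>n. sqw_sum m (x n) * sqw_sum m' (y n))
      (\<Sum>k<m. \<Sum>l<m'. sqw_coeff k * sqw_coeff l * f k l)"
    if "\<And>k l. cesaro_lim (\<lambda>n. c k (x n) * c l (y n)) (f k l)" for x y f m m'
  proof -
    have "cesaro_lim (\<lambda>n. \<Sum>k<m. \<Sum>l<m'. sqw_coeff k * sqw_coeff l * (c k (x n) * c l (y n)))
       (\<Sum>k<m. \<Sum>l<m'. sqw_coeff k * sqw_coeff l * f k l)"
      by (intro cesaro_lim_sum cesaro_lim_cmult that)
    also have "(\<lambda>n. \<Sum>k<m. \<Sum>l<m'. sqw_coeff k * sqw_coeff l * (c k (x n) * c l (y n)))
      = (\<lambda>n. sqw_sum m (x n) * sqw_sum m' (y n))"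
      by (simp add: sqw_sum_def sum_product c_def mult_ac)
    finally show ?thesis .
  qed
  \<comment> \<open>The mixed term contributes minus twice the sum of the
    \<open>(sqw_coeff k)\<^sup>2 / 2\<close>, and the square of the partial sum, by orthogonality,
    the same sum once. With the constant 1 this leaves \<open>\<delta> m\<close>.\<close>
  have defect: "cesaro_lim (\<lambda>n. 1 - 2 * (sqw (x n) * sqw_sum m (x n)) + sqw_sum m (x n) * sqw_sum m (x n)) (\<delta> m)"
    if s: "\<And>k. cesaro_lim (\<lambda>n. sqw (x n) * c k (x n)) (sqw_coeff k / 2)"
      and cc: "\<And>k l. cesaro_lim (\<lambda>n. c k (x n) * c l (x n)) (if k = l then 1 / 2 else 0)" for x m
  proof -
    have "cesaro_lim (\<lambda>n. \<Sum>k<m. sqw_coeff k * (sqw (x n) * c k (x n))) (\<Sum>k<m. sqw_coeff k * (sqw_coeff k / 2))"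
      by (intro cesaro_lim_sum cesaro_lim_cmult s)
    then have "cesaro_lim (\<lambda>n. sqw (x n) * sqw_sum m (x n)) (\<Sum>k<m. (sqw_coeff k)\<^sup>2 / 2)"
      by (simp add: sqw_sum_def sum_distrib_left c_def mult_ac power2_eq_square)
    from cesaro_lim_add[OF cesaro_lim_diff[OF cesaro_lim_const[of 1] cesaro_lim_cmult[OF this, of 2]] prod[OF cc, of m m]]
    show ?thesis
      by (simp add: \<delta>_def if_distrib[of "\<lambda>x. _ * x"] power2_eq_square cong: if_cong flip: sum_divide_distrib)
  qed
  have "\<delta> \<longlonglongrightarrow> 1 - 1"
    unfolding \<delta>_def using sqw_coeff_square_sums unfolding sums_def by (intro tendsto_intros)
  \<comment> \<open>\<open>\<eta>\<close> is fixed before the cutoffs. However large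
    \<open>1 / (2 * \<eta>)\<close> is, the defects tend to 0, so only \<open>\<eta>\<close> remains
    in the limit.\<close>
  then have "(\<lambda>L. \<eta> + (1 / (2 * \<eta>) + 1 / 2) * (\<delta> (M L) + \<delta> (M' L))) \<longlonglongrightarrow> \<eta> + (1 / (2 * \<eta>) + 1 / 2) * (0 + 0)"
    by (intro tendsto_intros filterlim_compose[OF _ M(1)] filterlim_compose[OF _ M(2)]) simp_all
  then have "\<forall>\<^sub>F L in sequentially. \<eta> + (1 / (2 * \<eta>) + 1 / 2) * (\<delta> (M L) + \<delta> (M' L)) < \<epsilon>"
    using \<open>\<eta> < \<epsilon>\<close> by (intro order_tendstoD(2)) auto
  moreover have "\<forall>\<^sub>F L in sequentially. \<bar>(\<Sum>k<M L. \<Sum>l<M' L. sqw_coeff k * sqw_coeff l * e k l) - E\<bar> < \<epsilon>"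
    using E \<open>\<epsilon> > 0\<close> unfolding tendsto_iff dist_real_def by blast
  ultimately have "\<forall>\<^sub>F L in sequentially. \<eta> + (1 / (2 * \<eta>) + 1 / 2) * (\<delta> (M L) + \<delta> (M' L)) < \<epsilon> \<and>
    \<bar>(\<Sum>k<M L. \<Sum>l<M' L. sqw_coeff k * sqw_coeff l * e k l) - E\<bar> < \<epsilon>"
    by (rule eventually_conj)
  then obtain L where L: "\<eta> + (1 / (2 * \<eta>) + 1 / 2) * (\<delta> (M L) + \<delta> (M' L)) < \<epsilon>"
    "\<bar>(\<Sum>k<M L. \<Sum>l<M' L. sqw_coeff k * sqw_coeff l * e k l) - E\<bar> < \<epsilon>"
    by (auto simp: eventually_sequentially)
  let ?d = "\<lambda>n. \<eta> + (1 / (2 * \<eta>) + 1 / 2) *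
    ((1 - 2 * (sqw (a n) * sqw_sum (M L) (a n)) + sqw_sum (M L) (a n) * sqw_sum (M L) (a n)) +
     (1 - 2 * (sqw (b n) * sqw_sum (M' L) (b n)) + sqw_sum (M' L) (b n) * sqw_sum (M' L) (b n)))"
  have "cesaro_lim ?d (\<eta> + (1 / (2 * \<eta>) + 1 / 2) * (\<delta> (M L) + \<delta> (M' L)))"
    by (intro cesaro_lim_add cesaro_lim_const cesaro_lim_cmult defect sa sb aa bb)
  moreover have "\<bar>sqw (a n) * sqw (b n) - sqw_sum (M L) (a n) * sqw_sum (M' L) (b n)\<bar> \<le> ?d n" for n
    by (rule sqw_product_approx[OF \<open>\<eta> > 0\<close> abs_sqw_le abs_sqw_le])
  ultimately show "\<exists>f d c' D. cesaro_lim f c' \<and> cesaro_lim d D \<and>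
    (\<forall>\<^sub>F n in sequentially. \<bar>sqw (a n) * sqw (b n) - f n\<bar> \<le> d n) \<and> \<bar>c' - E\<bar> \<le> \<epsilon> \<and> D \<le> \<epsilon>"
    using prod[OF ab, of "M L" "M' L"] less_imp_le[OF L(1)] less_imp_le[OF L(2)]
    by (intro exI conjI always_eventually allI)
qed

section \<open>Fourier integrals of the square wave\<close>

lemma sin_odd_pi_half: "sin (real (2 * k + 1) * (pi / 2)) = (-1) ^ k"
proof -
  have "sin (real (2 * k + 1) * (pi / 2)) = sin (real k * pi + pi / 2)"
    by (simp add: field_simps)
  also have "\<dots> = (-1) ^ k" unfolding sin_add by (simp add: mult.commute)
  finally show ?thesis .
qed

lemma sqw_cos_integral_piece:
  assumes "u \<le> v" and s: "\<And>t. u < t \<Longrightarrow> t < v \<Longrightarrow> sqw t = s" and "j \<noteq> 0"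
  shows "((\<lambda>t. sqw t * cos (2 * pi * j * t)) has_integral
    s / (2 * pi * j) * (sin (2 * pi * j * v) - sin (2 * pi * j * u))) {u..v}"
proof -
  have "((\<lambda>t. s * cos (2 * pi * j * t)) has_integral
    (s / (2 * pi * j) * sin (2 * pi * j * v) - s / (2 * pi * j) * sin (2 * pi * j * u))) {u..v}"
    using assms(1,3)
    by (intro fundamental_theorem_of_calculus)
      (auto intro!: derivative_eq_intros simp flip: has_real_derivative_iff_has_vector_derivative)
  then have "((\<lambda>t. sqw t * cos (2 * pi * j * t)) has_integral
    (s / (2 * pi * j) * sin (2 * pi * j * v) - s / (2 * pi * j) * sin (2 * pi * j * u))) {u..v}"
    by (rule has_integral_spike_finite[of "{u, v}", rotated 2]) (use s in auto)
  then show ?thesis by (simp add: right_diff_distrib)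
qed

lemma sqw_pieces:
  "-1/4 < t \<Longrightarrow> t < 1/4 \<Longrightarrow> sqw t = 1"
  "1/4 < t \<Longrightarrow> t < 3/4 \<Longrightarrow> sqw t = -1"
  "3/4 < t \<Longrightarrow> t < 5/4 \<Longrightarrow> sqw t = 1"
proof -
  have pos: "0 < cos (2 * pi * t)" if "-1/4 < t" "t < 1/4" for t
  proof (rule cos_gt_zero_pi)
    have "pi * (-1/4) < pi * t" "pi * t < pi * (1/4)" using that by (simp_all only: mult_less_cancel_left_pos pi_gt_zero)
    then show "- (pi / 2) < 2 * pi * t" "2 * pi * t < pi / 2" by simp_all
  qed
  show "sqw t = 1" if "-1/4 < t" "t < 1/4"
    using pos[OF that] by (simp add: sqw_def)
  show "sqw t = -1" if "1/4 < t" "t < 3/4"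
  proof -
    have "2 * pi * (t - 1/2) = 2 * pi * t - pi" by (simp add: algebra_simps)
    then show ?thesis using pos[of "t - 1/2"] that by (simp add: sqw_def cos_diff)
  qed
  show "sqw t = 1" if "3/4 < t" "t < 5/4"
  proof -
    have "2 * pi * (t - 1) = 2 * pi * t - 2 * pi" by (simp add: algebra_simps)
    then show ?thesis using pos[of "t - 1"] that by (simp add: sqw_def cos_diff)
  qed
qed

text \<open>Between consecutive zeros of the cosine the integral is elementary. For
  \<open>\<theta> = 0\<close> the zeros 1/4 and 3/4 cut the unit interval into three pieces; for
  \<open>\<theta> = 1/4\<close> a shift leads to [-1/4, 3/4], a period made of only two.\<close>

lemma sqw_cos_integral:
  fixes k :: nat and \<theta> :: real
  assumes "\<theta> = 0 \<or> \<theta> = 1/4"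
  shows "((\<lambda>t. sqw (t - \<theta>) * cos (2 * pi * real (2 * k + 1) * (t - \<theta>))) has_integral
    sqw_coeff k / 2) {0..1}"
proof -
  define j where "j = real (2 * k + 1)"
  have j: "j \<noteq> 0" by (simp add: j_def)
  let ?f = "\<lambda>t. sqw t * cos (2 * pi * j * t)"
  have q: "sin (2 * pi * j * (1/4)) = (-1) ^ k" 
  proof -
    have eq: "2 * pi * j * (1/4) = real (2 * k + 1) * (pi / 2)"
      by (simp add: j_def)
    show ?thesis unfolding eq sin_odd_pi_half by simp
  qed
  have q3: "sin (2 * pi * j * (3/4)) = - ((-1) ^ k)"
  proof -
    \<comment> \<open>Three times an odd number is odd: 3(2k+1) = 2(3k+1) + 1, and 3k + 1 has the
      parity opposite to k, hence the minus sign.\<close>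
    have eq: "2 * pi * j * (3/4) = real (2 * (3 * k + 1) + 1) * (pi / 2)"
      by (simp add: j_def algebra_simps)
    show ?thesis unfolding eq sin_odd_pi_half by (simp add: power_mult)
  qed
  have q1: "sin (2 * pi * j * 1) = 0"
    using sin_npi[of "2 * (2 * k + 1)"] by (simp add: j_def field_simps)
  have c: "sqw_coeff k / 2 = 2 * (-1) ^ k / (pi * j)" 
    by (simp add: sqw_coeff_def j_def)
  note piece = sqw_cos_integral_piece[OF _ _ j]
  show ?thesis
  proof (cases "\<theta> = 0")
    case True
    have "(?f has_integral 1 / (2 * pi * j) * (sin (2 * pi * j * (1/4)) - sin (2 * pi * j * 0))) {0..1/4}"
      by (rule piece) (auto simp: sqw_pieces)
    moreover have "(?f has_integral (-1) / (2 * pi * j) * (sin (2 * pi * j * (3/4)) - sin (2 * pi * j * (1/4)))) {1/4..3/4}"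
      by (rule piece) (auto simp: sqw_pieces)
    ultimately have "(?f has_integral (1 / (2 * pi * j) * (sin (2 * pi * j * (1/4)) - sin (2 * pi * j * 0)) 
       + (-1) / (2 * pi * j) * (sin (2 * pi * j * (3/4)) - sin (2 * pi * j * (1/4))))) {0..3/4}"
      by (intro has_integral_combine[where b="3/4" and c="1/4"]) auto
    moreover have "(?f has_integral 1 / (2 * pi * j) * (sin (2 * pi * j * 1) - sin (2 * pi * j * (3/4)))) {3/4..1}"
      by (rule piece) (auto simp: sqw_pieces)
    ultimately have "(?f has_integral (1 / (2 * pi * j) * (sin (2 * pi * j * (1/4)) - sin (2 * pi * j * 0)) 
       + (-1) / (2 * pi * j) * (sin (2 * pi * j * (3/4)) - sin (2 * pi * j * (1/4)))
       + 1 / (2 * pi * j) * (sin (2 * pi * j * 1) - sin (2 * pi * j * (3/4))))) {0..1}"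
      by (intro has_integral_combine[where b="1" and c="3/4"]) auto
    then have "(?f has_integral sqw_coeff k / 2) {0..1}"
      unfolding c q q3 q1 by (simp add: field_simps)
    then show ?thesis using True by (simp add: j_def)
  next
    case False
    have "(?f has_integral 1 / (2 * pi * j) * (sin (2 * pi * j * (1/4)) - sin (2 * pi * j * (- (1/4))))) {-(1/4)..1/4}"
      by (rule piece) (auto simp: sqw_pieces)
    moreover have "(?f has_integral (-1) / (2 * pi * j) * (sin (2 * pi * j * (3/4)) - sin (2 * pi * j * (1/4)))) {1/4..3/4}"
      by (rule piece) (auto simp: sqw_pieces)
    ultimately have "(?f has_integral (1 / (2 * pi * j) * (sin (2 * pi * j * (1/4)) - sin (2 * pi * j * (- (1/4)))) 
       + (-1) / (2 * pi * j) * (sin (2 * pi * j * (3/4)) - sin (2 * pi * j * (1/4))))) {-(1/4)..3/4}"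
      by (intro has_integral_combine[where b="3/4" and c="1/4"]) auto
    moreover have "sin (2 * pi * j * (- (1/4))) = - ((-1) ^ k)"
      using q by (simp only: mult_minus_right sin_minus)
    ultimately have "(?f has_integral sqw_coeff k / 2) {-(1/4)..3/4}"
      unfolding c q q3 by (simp add: field_simps)
    then have "((\<lambda>t. ?f (t + - (1/4))) has_integral sqw_coeff k / 2) {0..1}"
      using has_integral_shift_real_ivl[of ?f "sqw_coeff k / 2" "-(1/4)" "3/4" "-(1/4)"]
      by simp
    moreover have "\<theta> = 1/4" using False assms by simp
    ultimately show ?thesis by (simp only: j_def) simp
  qed
qed

section \<open>Means along sequences equidistributed modulo 1\<close>

lemma countable_cos_zeros: "countable {t. cos (2 * pi * (t - \<theta>)) = 0}"
proof (rule countable_subset)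
  show "{t. cos (2 * pi * (t - \<theta>)) = 0} \<subseteq> range (\<lambda>i::int. of_int i / 4 + \<theta>)"
  proof safe
    fix t assume "cos (2 * pi * (t - \<theta>)) = 0"
    \<comment> \<open>The zeros belong to odd \<open>i\<close>; the oddness is dropped because a
      countable superset is enough.\<close>
    then obtain i :: int where "2 * pi * (t - \<theta>) = of_int i * (pi / 2)"
      unfolding cos_zero_iff_int by blast
    then have "pi * (4 * (t - \<theta>)) = pi * of_int i" by (simp add: field_simps)
    then have "4 * (t - \<theta>) = of_int i" unfolding mult_cancel_left by simp
    then show "t \<in> range (\<lambda>i::int. of_int i / 4 + \<theta>)" by (auto intro!: image_eqI[of _ _ i])
  qed
qed simp

lemma isCont_sqw: "cos (2 * pi * (t - \<theta>)) \<noteq> 0 \<Longrightarrow> isCont (\<lambda>t. sqw (t - \<theta>)) t"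
  unfolding sqw_def by (intro isCont_sgn continuous_intros)

lemma cos_frac: "cos (2 * pi * (real m * (frac u - \<theta>)) + \<phi>) = cos (2 * pi * (real m * (u - \<theta>)) + \<phi>)"
proof -
  have "2 * pi * (real m * (u - \<theta>)) + \<phi> = 2 * pi * (real m * (frac u - \<theta>)) + \<phi> + 2 * pi * of_int (int m * \<lfloor>u\<rfloor>)"
    by (simp add: frac_def algebra_simps)
  then show ?thesis
    by (simp only: cos_add[of _ "2 * pi * of_int _"] cos_int_2pin sin_int_2pin mult_1_right mult_zero_right diff_zero)
qed

lemma sqw_frac: "sqw (frac u - \<theta>) = sqw (u - \<theta>)"
  using cos_frac[of 1 u \<theta> 0] by (simp add: sqw_def)

lemma equidistributed_mod1_sqw:
  assumes "equidistributed_mod1 u" and "\<theta> = 0 \<or> \<theta> = 1/4"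
  shows "cesaro_lim (\<lambda>n. sqw (u n - \<theta>) * cos (2 * pi * real (2 * k + 1) * (u n - \<theta>))) (sqw_coeff k / 2)"
proof -
  let ?F = "\<lambda>t. sqw (t - \<theta>) * cos (2 * pi * real (2 * k + 1) * (t - \<theta>))"
  have "cesaro_lim (\<lambda>n. ?F (frac (u n))) (integral {0..1} ?F)"
  proof (rule equidistributed_cesaro_lim)
    show "equidistributed (\<lambda>n. frac (u n))" using assms(1) by (simp add: equidistributed_mod1_def)
    have "{t. \<not> isCont ?F t} \<subseteq> {t. cos (2 * pi * (t - \<theta>)) = 0}"
      by (auto intro!: continuous_intros isCont_sqw)
    then show "{t. \<not> isCont ?F t} \<in> null_sets lborel"
      by (intro countable_imp_null_set_lborel countable_subset[OF _ countable_cos_zeros])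
    show "\<bar>?F t\<bar> \<le> 1 * 1" for t
      unfolding abs_mult by (intro mult_mono abs_sqw_le) auto
    show "?F \<in> borel_measurable borel" unfolding sqw_def by measurable
  qed
  moreover have "?F (frac t) = ?F t" for t
    using cos_frac[of "2 * k + 1" t \<theta> 0] by (simp only: sqw_frac mult.assoc add_0_right)
  ultimately show ?thesis
    unfolding integral_unique[OF sqw_cos_integral[OF assms(2)]] by simp
qed

text \<open>Frequency one suffices: other frequencies are absorbed into the factor \<open>x\<close>
  of the sequences \<open>s n * x\<close>, which are equidistributed for every nonzero
  \<open>x\<close>.\<close>

lemma equidistributed_mod1_cos:
  assumes "equidistributed_mod1 u"
  shows "cesaro_lim (\<lambda>n. cos (2 * pi * u n + \<phi>)) 0"
proof -
  let ?F = "\<lambda>t. cos (2 * pi * t + \<phi>)"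
  have "cesaro_lim (\<lambda>n. ?F (frac (u n))) (integral {0..1} ?F)"
  proof (rule equidistributed_cesaro_lim)
    show "equidistributed (\<lambda>n. frac (u n))" using assms(1) by (simp add: equidistributed_mod1_def)
    have "{t. \<not> isCont ?F t} = {}"
      by (auto intro!: continuous_intros)
    then show "{t. \<not> isCont ?F t} \<in> null_sets lborel" by simp
    show "\<bar>?F t\<bar> \<le> 1" for t by simp
  qed measurable
  moreover have "(?F has_integral (sin (2 * pi * 1 + \<phi>) / (2 * pi) - sin (2 * pi * 0 + \<phi>) / (2 * pi))) {0..1}"
    by (intro fundamental_theorem_of_calculus)
      (auto intro!: derivative_eq_intros simp flip: has_real_derivative_iff_has_vector_derivative)
  then have "(?F has_integral 0) {0..1}" by (simp add: sin_add)
  ultimately show ?thesis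
    using cos_frac[of 1 _ 0 \<phi>] by (simp add: integral_unique)
qed

section \<open>Correlations of square waves\<close>

text \<open>The mean of the product of the harmonic \<open>2 * k + 1\<close> at \<open>x\<close> and
  the harmonic \<open>2 * l + 1\<close> at \<open>y\<close>. Product-to-sum leaves a difference and
  a sum frequency; each contributes only when it is zero, and then only its constant phase
  remains.\<close>

definition phase_corr :: "real \<Rightarrow> real \<Rightarrow> real \<Rightarrow> nat \<Rightarrow> nat \<Rightarrow> real" where
  "phase_corr x y \<theta> k l =
     ((if real (2 * k + 1) * x = real (2 * l + 1) * y
       then cos (2 * pi * (real (2 * k + 1) - real (2 * l + 1)) * \<theta>) else 0) +
      (if real (2 * k + 1) * x = - (real (2 * l + 1) * y)
       then cos (2 * pi * (real (2 * k + 1) + real (2 * l + 1)) * \<theta>) else 0)) / 2"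

lemma cesaro_lim_phase_corr:
  fixes s :: "nat \<Rightarrow> real"
  assumes equi: "\<And>x. x \<noteq> 0 \<Longrightarrow> equidistributed_mod1 (\<lambda>n. s n * x)"
  shows "cesaro_lim (\<lambda>n. cos (2 * pi * real (2 * k + 1) * (s n * x - \<theta>)) * 
     cos (2 * pi * real (2 * l + 1) * (s n * y - \<theta>))) (phase_corr x y \<theta> k l)"
proof -
  define i j where "i = real (2 * k + 1)" and "j = real (2 * l + 1)"
  have single: "cesaro_lim (\<lambda>n. cos (2 * pi * (s n * z) - \<phi>)) (if z = 0 then cos \<phi> else 0)" for z \<phi>
  proof (cases "z = 0")
    case False
    then show ?thesis using equidistributed_mod1_cos[OF equi[OF False], of "- \<phi>"] by simp
  qed (simp add: cesaro_lim_const)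
  have "cesaro_lim (\<lambda>n. 1 / 2 * (cos (2 * pi * (s n * (i * x - j * y)) - 2 * pi * (i - j) * \<theta>) +
      cos (2 * pi * (s n * (i * x + j * y)) - 2 * pi * (i + j) * \<theta>)))
     (1 / 2 * ((if i * x - j * y = 0 then cos (2 * pi * (i - j) * \<theta>) else 0) +
       (if i * x + j * y = 0 then cos (2 * pi * (i + j) * \<theta>) else 0)))"
    by (intro cesaro_lim_cmult cesaro_lim_add single)
  also have "(\<lambda>n. 1 / 2 * (cos (2 * pi * (s n * (i * x - j * y)) - 2 * pi * (i - j) * \<theta>) +
      cos (2 * pi * (s n * (i * x + j * y)) - 2 * pi * (i + j) * \<theta>))) =
    (\<lambda>n. cos (2 * pi * i * (s n * x - \<theta>)) * cos (2 * pi * j * (s n * y - \<theta>)))"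
    unfolding cos_times_cos by (simp add: algebra_simps add_divide_distrib)
  also have "(1 / 2 * ((if i * x - j * y = 0 then cos (2 * pi * (i - j) * \<theta>) else 0) +
       (if i * x + j * y = 0 then cos (2 * pi * (i + j) * \<theta>) else 0))) = phase_corr x y \<theta> k l"
    unfolding phase_corr_def i_def[symmetric] j_def[symmetric] eq_neg_iff_add_eq_0 by simp
  finally show ?thesis unfolding i_def j_def .
qed

text \<open>Orthogonality of the odd harmonics along the sequence: both frequencies are positive
  multiples of the same \<open>x\<close>, so their sum cannot vanish and their difference vanishes
  only for \<open>k = l\<close>.\<close>

lemma phase_corr_diagonal: "x \<noteq> 0 \<Longrightarrow> phase_corr x x \<theta> k l = (if k = l then 1 / 2 else 0)"
proof -
  assume x: "x \<noteq> 0"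
  have "real (2 * k + 1) * x \<noteq> - (real (2 * l + 1) * x)"
  proof
    assume "real (2 * k + 1) * x = - (real (2 * l + 1) * x)"
    then have "(real (2 * k + 1) + real (2 * l + 1)) * x = 0" by (simp add: algebra_simps)
    then show False using x by simp
  qed
  then show ?thesis using x by (auto simp: phase_corr_def)
qed

lemma cesaro_lim_sqw:
  fixes s :: "nat \<Rightarrow> real"
  assumes equi: "\<And>x. x \<noteq> 0 \<Longrightarrow> equidistributed_mod1 (\<lambda>n. s n * x)"
    and xy: "x \<noteq> 0" "y \<noteq> 0" and \<theta>: "\<theta> = 0 \<or> \<theta> = 1/4"
    and M: "filterlim M at_top sequentially" "filterlim M' at_top sequentially"
    and E: "(\<lambda>L. \<Sum>k<M L. \<Sum>l<M' L. sqw_coeff k * sqw_coeff l * phase_corr x y \<theta> k l) \<longlonglongrightarrow> E"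
  shows "cesaro_lim (\<lambda>n. sqw (s n * x - \<theta>) * sqw (s n * y - \<theta>)) E"
proof (rule sqw_correlation[where e = "phase_corr x y \<theta>"])
  have "cesaro_lim (\<lambda>n. cos (2 * pi * real (2 * k + 1) * (s n * z - \<theta>)) * 
     cos (2 * pi * real (2 * l + 1) * (s n * z - \<theta>))) (if k = l then 1 / 2 else 0)"
    if "z \<in> {x, y}" for z k l
    using cesaro_lim_phase_corr[OF equi, of k z \<theta> l z] phase_corr_diagonal[of z \<theta> k l] that xy by auto
  then show "cesaro_lim (\<lambda>n. cos (2 * pi * real (2 * k + 1) * (s n * x - \<theta>)) * 
     cos (2 * pi * real (2 * l + 1) * (s n * x - \<theta>))) (if k = l then 1 / 2 else 0)"
   "cesaro_lim (\<lambda>n. cos (2 * pi * real (2 * k + 1) * (s n * y - \<theta>)) * 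
     cos (2 * pi * real (2 * l + 1) * (s n * y - \<theta>))) (if k = l then 1 / 2 else 0)" for k l
    by blast+
  show "cesaro_lim (\<lambda>n. cos (2 * pi * real (2 * k + 1) * (s n * x - \<theta>)) * 
     cos (2 * pi * real (2 * l + 1) * (s n * y - \<theta>))) (phase_corr x y \<theta> k l)" for k l
    by (rule cesaro_lim_phase_corr[OF equi])
  show "cesaro_lim (\<lambda>n. sqw (s n * x - \<theta>) * cos (2 * pi * real (2 * k + 1) * (s n * x - \<theta>))) (sqw_coeff k / 2)"
    "cesaro_lim (\<lambda>n. sqw (s n * y - \<theta>) * cos (2 * pi * real (2 * k + 1) * (s n * y - \<theta>))) (sqw_coeff k / 2)" for k
    by (intro equidistributed_mod1_sqw equi xy \<theta>)+
qed (fact M E)+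

section \<open>Resonances for a rational ratio\<close>

text \<open>By coprimality \<open>q\<close> divides \<open>2 * k + 1\<close>, with an odd quotient
  because the product is odd. Writing the quotient as \<open>2 * s + 1\<close> turns
  \<open>k\<close> into \<open>Q + s * q\<close>, and cancelling \<open>q\<close> gives
  \<open>l\<close> with the same \<open>s\<close>.\<close>

lemma odd_prod_frequencies:
  fixes P Q L :: nat
  defines "p \<equiv> 2 * P + 1" and "q \<equiv> 2 * Q + 1"
  assumes "coprime p q"
  shows "(\<Sum>k<q * L. \<Sum>l<p * L. if (2 * k + 1) * p = (2 * l + 1) * q then f k l else (0::real)) =
    (\<Sum>s<L. f (Q + s * q) (P + s * p))"
proof -
  let ?h = "\<lambda>s. (Q + s * q, P + s * p)"
  let ?A = "{(k, l). k < q * L \<and> l < p * L \<and> (2 * k + 1) * p = (2 * l + 1) * q}"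
  have inj: "inj_on ?h {..<L}" 
    by (rule inj_onI) (simp add: q_def del: mult_Suc_right mult_Suc)
  \<comment> \<open>Since \<open>Q < q\<close>, the offset does not push the index
    \<open>s = L - 1\<close> past the cutoff. Stated for arbitrary odd numbers, so that it serves
    both \<open>q\<close> and \<open>p\<close>.\<close>
  have lt: "Q + s * q < q * L \<longleftrightarrow> s < L" if "q = 2 * Q + 1" for s Q q :: nat
  proof
    assume "s < L"
    then have "(s + 1) * q \<le> L * q" by (intro mult_right_mono) auto
    then show "Q + s * q < q * L" using that by (simp add: algebra_simps)
  next
    assume "Q + s * q < q * L"
    then have "q * s < q * L" by (metis add_lessD1 mult.commute add.commute)
    then show "s < L" by simp
  qed
  have "?A = ?h ` {..<L}"
  proof (intro equalityI subsetI)
    fix z assume "z \<in> ?A"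
    then obtain k l where z: "z = (k, l)" and k: "k < q * L" and l: "l < p * L"
      and e: "(2 * k + 1) * p = (2 * l + 1) * q" by auto
    have "q dvd (2 * k + 1) * p" using e by simp
    then have "q dvd 2 * k + 1"
      using coprime_dvd_mult_left_iff[of q p "2 * k + 1"] \<open>coprime p q\<close> by (simp only: coprime_commute)
    then obtain t where t: "2 * k + 1 = q * t" by blast
    then have "odd t" by (metis even_mult_iff even_plus_one_iff dvd_triv_left)
    then obtain s where s: "t = 2 * s + 1" by (elim oddE)
    have "k = Q + s * q" using t s by (simp add: q_def algebra_simps)
    moreover have "(2 * l + 1) * q = (t * p) * q" using e[symmetric] unfolding t by (simp only: mult_ac)
    then have "2 * l + 1 = t * p" by (simp only: mult_cancel_right) (simp add: q_def)
    then have "l = P + s * p" using s by (simp add: p_def algebra_simps)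
    moreover have "s < L" using k lt[OF meta_eq_to_obj_eq[OF q_def]] calculation by simp
    ultimately show "z \<in> ?h ` {..<L}" using z by auto
  next
    fix z assume "z \<in> ?h ` {..<L}"
    then obtain s where "s < L" "z = ?h s" by auto
    then show "z \<in> ?A"
      using lt[OF meta_eq_to_obj_eq[OF q_def], of s] lt[OF meta_eq_to_obj_eq[OF p_def], of s]
      by (auto simp: p_def q_def algebra_simps)
  qed
  moreover have "(\<Sum>k<q * L. \<Sum>l<p * L. if (2 * k + 1) * p = (2 * l + 1) * q then f k l else 0) = (\<Sum>(k, l)\<in>?A. f k l)"
    unfolding sum.cartesian_product
    by (rule sum.mono_neutral_cong_right) (auto simp del: mult_Suc_right split: if_splits)
  ultimately show ?thesis
    by (simp add: sum.reindex[OF inj])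
qed

lemma phase_corr_eq_0_irrational:
  assumes "y \<noteq> 0" "x / y \<notin> \<rat>"
  shows "phase_corr x y \<theta> k l = 0"
proof -
  have "real (2 * k + 1) * x \<noteq> c * (real (2 * l + 1) * y)" if "c \<in> \<rat>" for c
  proof
    assume "real (2 * k + 1) * x = c * (real (2 * l + 1) * y)"
    then have "x / y = c * real (2 * l + 1) / real (2 * k + 1)"
      using assms(1) by (simp add: field_simps)
    then show False using assms(2) that by (metis Rats_divide Rats_mult Rats_of_nat)
  qed
  from this[of 1] this[of "-1"] show ?thesis by (simp add: phase_corr_def)
qed


text \<open>With the sign of the ratio split off as \<open>\<delta>\<close>, only one resonance is
  possible: the difference frequency for \<open>\<delta> = 1\<close>, the sum frequency for
  \<open>\<delta> = -1\<close>. Both phases then take the common form with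
  \<open>- \<delta>\<close>.\<close>

lemma phase_corr_rational:
  fixes x y \<delta> :: real and p q :: nat
  assumes "y \<noteq> 0" "p > 0" "q > 0" and \<delta>: "\<delta> = 1 \<or> \<delta> = -1" and x: "x / y = \<delta> * real p / real q"
  shows "phase_corr x y \<theta> k l = (if (2 * k + 1) * p = (2 * l + 1) * q then
    cos (2 * pi * (real (2 * k + 1) - \<delta> * real (2 * l + 1)) * \<theta>) / 2 else 0)"
proof -
  define i j where "i = real (2 * k + 1)" and "j = real (2 * l + 1)"
  have pos: "i > 0" "j > 0" by (auto simp: i_def j_def)
  have iff: "i * x = c * (j * y) \<longleftrightarrow> \<delta> * (i * real p) = c * (j * real q)" for c
  proof -
    have "x = \<delta> * real p / real q * y" using x \<open>y \<noteq> 0\<close> by (simp add: field_simps)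
    then have "i * x = c * (j * y) \<longleftrightarrow> (i * \<delta> * real p / real q) * y = (c * j) * y" by (simp add: mult_ac)
    also have "\<dots> \<longleftrightarrow> i * \<delta> * real p / real q = c * j" using \<open>y \<noteq> 0\<close> by (simp only: mult_cancel_right) simp
    also have "\<dots> \<longleftrightarrow> \<delta> * (i * real p) = c * (j * real q)" using \<open>q > 0\<close> by (simp add: field_simps)
    finally show ?thesis .
  qed
  have neg: "i * real p \<noteq> - (j * real q)" "- (i * real p) \<noteq> j * real q"
  proof -
    have "i * real p > 0" "j * real q > 0" using pos assms(2,3) by simp_all
    then show "i * real p \<noteq> - (j * real q)" "- (i * real p) \<noteq> j * real q" by linarith+
  qed
  have nat: "(2 * k + 1) * p = (2 * l + 1) * q \<longleftrightarrow> i * real p = j * real q"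
    unfolding i_def j_def of_nat_mult[symmetric] of_nat_eq_iff ..
  show ?thesis
    using \<delta> iff[of 1] iff[of "-1"] neg unfolding phase_corr_def i_def[symmetric] j_def[symmetric] nat
    by auto
qed

text \<open>The two cutoffs may differ: with \<open>k < q L\<close> and \<open>l < p L\<close> the resonant pairs are exactly
  those with \<open>s < L\<close>.\<close>

definition corr_lim :: "real \<Rightarrow> real \<Rightarrow> real \<Rightarrow> real \<Rightarrow> bool" where
  "corr_lim x y \<theta> E \<longleftrightarrow> (\<exists>M M'. filterlim M at_top sequentially \<and> filterlim M' at_top sequentially \<and>
    (\<lambda>L. \<Sum>k<M L. \<Sum>l<M' L. sqw_coeff k * sqw_coeff l * phase_corr x y \<theta> k l) \<longlonglongrightarrow> E)"

lemma corr_lim_0: "(\<And>k l. phase_corr x y \<theta> k l = 0) \<Longrightarrow> corr_lim x y \<theta> 0"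
  unfolding corr_lim_def by (intro exI[of _ "\<lambda>L. L"]) (simp add: filterlim_ident)

text \<open>At the resonance with index \<open>s\<close> the phase involves
  \<open>(q - \<delta> p)(2 s + 1)\<close>; the phase factor is assumed to be the same number
  \<open>c\<close> for all \<open>s\<close>. The factor 8/pi^2, from two coefficients 4/pi and the
  1/2 in \<open>phase_corr\<close>, cancels against the value pi^2/8 of the series.\<close>

lemma corr_lim_odd:
  fixes P Q :: nat and \<delta> :: real
  defines "p \<equiv> 2 * P + 1" and "q \<equiv> 2 * Q + 1"
  assumes "coprime p q" "y \<noteq> 0" "\<delta> = 1 \<or> \<delta> = -1" "x / y = \<delta> * real p / real q"
    and c: "\<And>s. cos (2 * pi * ((real q - \<delta> * real p) * real (2 * s + 1)) * \<theta>) = c"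
  shows "corr_lim x y \<theta> (c * (-1) ^ (P + Q) / (real p * real q))"
proof -
  have lims: "filterlim (\<lambda>L. n * L) at_top sequentially" if "n > 0" for n :: nat
    using that by (simp add: filterlim_subseq strict_mono_def)
  have coeff: "sqw_coeff (Q + s * q) * sqw_coeff (P + s * p) * (c / 2) =
     8 / pi\<^sup>2 * (c * (-1) ^ (P + Q) / (real p * real q)) * (1 / (real (2 * s + 1))\<^sup>2)" for s
  proof -
    have 1: "real (2 * (Q + s * q) + 1) = real q * real (2 * s + 1)" "real (2 * (P + s * p) + 1) = real p * real (2 * s + 1)"
      by (simp_all add: p_def q_def algebra_simps)
    \<comment> \<open>The two coefficient signs multiply to the sign of parity
      \<open>P + Q + s * (q + p)\<close>. As \<open>q + p\<close> is even, the result does not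
      depend on \<open>s\<close>.\<close>
    have "even (q + p)" by (simp add: p_def q_def)
    then have "(-1 :: real) ^ (s * (q + p)) = 1" by simp
    then have 2: "(-1 :: real) ^ (Q + s * q) * (-1) ^ (P + s * p) = (-1) ^ (P + Q)"
      by (simp add: power_add[symmetric] algebra_simps) (simp add: power_add)
    have "sqw_coeff (Q + s * q) * sqw_coeff (P + s * p) = 16 / pi\<^sup>2 * ((-1) ^ (Q + s * q) * (-1) ^ (P + s * p)) /
      (real q * real (2 * s + 1) * (real p * real (2 * s + 1)))"
      unfolding sqw_coeff_def 1 by (simp add: power2_eq_square)
    then show ?thesis unfolding 2 by (simp add: power2_eq_square mult_ac)
  qed
  have "(\<Sum>k<q * L. \<Sum>l<p * L. sqw_coeff k * sqw_coeff l * phase_corr x y \<theta> k l) =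
    8 / pi\<^sup>2 * (c * (-1) ^ (P + Q) / (real p * real q)) * (\<Sum>s<L. 1 / (real (2 * s + 1))\<^sup>2)" for L
  proof -
    have "(\<Sum>k<q * L. \<Sum>l<p * L. sqw_coeff k * sqw_coeff l * phase_corr x y \<theta> k l) =
      (\<Sum>k<q * L. \<Sum>l<p * L. if (2 * k + 1) * p = (2 * l + 1) * q then sqw_coeff k * sqw_coeff l * 
        (cos (2 * pi * (real (2 * k + 1) - \<delta> * real (2 * l + 1)) * \<theta>) / 2) else 0)"
      using assms by (intro sum.cong refl) (simp add: phase_corr_rational[of y p q \<delta>] p_def q_def)
    also have "\<dots> = (\<Sum>s<L. sqw_coeff (Q + s * q) * sqw_coeff (P + s * p) *
        (cos (2 * pi * (real (2 * (Q + s * q) + 1) - \<delta> * real (2 * (P + s * p) + 1)) * \<theta>) / 2))"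
      unfolding p_def q_def by (rule odd_prod_frequencies) (use assms in simp)
    also have "\<dots> = (\<Sum>s<L. sqw_coeff (Q + s * q) * sqw_coeff (P + s * p) * (c / 2))"
    proof (intro sum.cong refl)
      fix s
      have "real (2 * (Q + s * q) + 1) - \<delta> * real (2 * (P + s * p) + 1) = (real q - \<delta> * real p) * real (2 * s + 1)"
        by (simp add: p_def q_def algebra_simps)
      then show "sqw_coeff (Q + s * q) * sqw_coeff (P + s * p) *
        (cos (2 * pi * (real (2 * (Q + s * q) + 1) - \<delta> * real (2 * (P + s * p) + 1)) * \<theta>) / 2) =
        sqw_coeff (Q + s * q) * sqw_coeff (P + s * p) * (c / 2)" by (simp only: c)
    qed
    finally show ?thesis unfolding coeff sum_distrib_left .
  qed
  moreover have "(\<lambda>L. 8 / pi\<^sup>2 * (c * (-1) ^ (P + Q) / (real p * real q)) * (\<Sum>s<L. 1 / (real (2 * s + 1))\<^sup>2))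
     \<longlonglongrightarrow> 8 / pi\<^sup>2 * (c * (-1) ^ (P + Q) / (real p * real q)) * (pi\<^sup>2 / 8)"
    using odd_inverse_squares_sums unfolding sums_def by (intro tendsto_intros)
  ultimately show ?thesis unfolding corr_lim_def
    by (intro exI[of _ "\<lambda>L. q * L"] exI[of _ "\<lambda>L. p * L"] conjI lims) (simp_all add: p_def q_def)
qed

text \<open>For odd \<open>p\<close> and \<open>q\<close> the limits at the two phases have the same
  absolute value, and their relative sign is decided by the parity of (q - p)/2, so they add up or
  cancel. If one of \<open>p\<close>, \<open>q\<close> is even, there are no resonances at
  all.\<close>

lemma corr_lim_rational_pos:
  fixes p q :: int
  assumes "y \<noteq> 0" "p \<noteq> 0" "q > 0" "coprime p q" "x / y = real_of_int p / real_of_int q"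
  shows "\<exists>E E'. corr_lim x y 0 E \<and> corr_lim x y (1/4) E' \<and>
    E + E' = (if odd p \<and> odd q \<and> 4 dvd (q - p) then 2 / (real_of_int p * real_of_int q) else 0)"
proof -
  define p' q' where "p' = nat \<bar>p\<bar>" and "q' = nat q"
  define \<delta> :: real where "\<delta> = sgn (real_of_int p)"
  have \<delta>: "\<delta> = 1 \<or> \<delta> = -1" using assms(2) by (auto simp: \<delta>_def sgn_real_def)
  have p: "real_of_int p = \<delta> * real p'" and q: "real_of_int q = real q'"
    using assms(3) by (auto simp: \<delta>_def p'_def q'_def sgn_mult_abs)
  have pos: "p' > 0" "q' > 0" using assms by (auto simp: p'_def q'_def)
  have cop: "coprime p' q'" using assms(3,4) by (simp add: p'_def q'_def coprime_int_iff[symmetric])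
  have x: "x / y = \<delta> * real p' / real q'" using assms(5) by (simp add: p q)
  have par: "odd p \<longleftrightarrow> odd p'" "odd q \<longleftrightarrow> odd q'" using assms(3) by (simp_all add: p'_def q'_def even_nat_iff)
  show ?thesis
  proof (cases "odd p' \<and> odd q'")
    case False
    \<comment> \<open>A resonance would force \<open>p'\<close> and \<open>q'\<close> to have equal
      parity. As they are not both odd, both would be even, against coprimality.\<close>
    have "(2 * k + 1) * p' \<noteq> (2 * l + 1) * q'" for k l
    proof
      assume "(2 * k + 1) * p' = (2 * l + 1) * q'"
      then have "even ((2 * k + 1) * p') = even ((2 * l + 1) * q')" by (rule arg_cong)
      then have "even p' = even q'" by simp
      then show False using False cop coprime_common_divisor[of p' q' 2] by auto
    qed
    then have "phase_corr x y \<theta> k l = 0" for \<theta> k l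
      by (subst phase_corr_rational[OF assms(1) pos \<delta> x]) auto
    then show ?thesis using False by (intro exI[of _ 0]) (auto intro: corr_lim_0 simp: par)
  next
    case True
    then obtain P Q where PQ: "p' = 2 * P + 1" "q' = 2 * Q + 1" by (metis oddE)
    have c0: "corr_lim x y 0 (1 * (-1) ^ (P + Q) / (real p' * real q'))"
      using corr_lim_odd[of P Q y \<delta> x 0 1] cop assms(1) \<delta> x unfolding PQ by simp
    obtain m where m: "q - p = 2 * m" using True par by (metis even_diff evenE odd_add odd_even_add)
    have "cos (2 * pi * ((real q' - \<delta> * real p') * real (2 * s + 1)) * (1/4)) = (if even m then 1 else -1)" for s
    proof -
      have "real q' - \<delta> * real p' = real_of_int (2 * m)" by (simp add: p[symmetric] q[symmetric] flip: m)
      \<comment> \<open>A quarter of 2 pi times \<open>2 * m\<close> is pi times \<open>m\<close>.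
        The factor \<open>2 * s + 1\<close> is odd and leaves the parity of \<open>m\<close>
        unchanged, so the cosine is the same for every \<open>s\<close>.\<close>
      then have "2 * pi * ((real q' - \<delta> * real p') * real (2 * s + 1)) * (1/4) = pi * of_int (m * (2 * int s + 1))"
        by simp
      also have "cos \<dots> = (if even m then 1 else -1)"
        by (simp only: cos_npi_int even_mult_iff) simp
      finally show ?thesis .
    qed
    then have c1: "corr_lim x y (1/4) ((if even m then 1 else -1) * (-1) ^ (P + Q) / (real p' * real q'))"
      using corr_lim_odd[of P Q y \<delta> x "1/4" "if even m then 1 else -1"] cop assms(1) \<delta> x unfolding PQ by blast
    have "1 * (-1) ^ (P + Q) / (real p' * real q') + (if even m then 1 else -1) * (-1) ^ (P + Q) / (real p' * real q') =
      (if odd p \<and> odd q \<and> 4 dvd (q - p) then 2 / (real_of_int p * real_of_int q) else 0)"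
    proof -
      have 4: "4 dvd (q - p) \<longleftrightarrow> even m" unfolding m by presburger
      \<comment> \<open>For positive \<open>p\<close>, \<open>m\<close> is \<open>Q - P\<close>; for
        negative \<open>p\<close> it is \<open>Q + P + 1\<close>. For even \<open>m\<close> the sign
        is therefore that of \<open>p\<close>, which turns the denominator \<open>p' * q'\<close>
        into the signed product \<open>p * q\<close>.\<close>
      have "(-1) ^ (P + Q) = \<delta>" if "even m"
      proof (cases "p > 0")
        case True
        then have "q - p = 2 * (int Q - int P)" using PQ pos by (simp add: p'_def q'_def)
        then have "even (P + Q)" using that m by (metis even_diff even_of_nat mult_left_cancel add.commute of_nat_add zero_neq_numeral)
        then show ?thesis using True by (simp add: \<delta>_def)
      next
        case False
        then have "q - p = 2 * (int Q + int P + 1)" using PQ pos assms(2,3) by (simp add: p'_def q'_def)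
        then have "odd (P + Q)" using that m by presburger
        then show ?thesis using False assms(2) by (simp add: \<delta>_def sgn_real_def)
      qed
      then show ?thesis using 4 par True \<delta> unfolding p q by auto
    qed
    then show ?thesis using c0 c1 by blast
  qed
qed

text \<open>Negating both \<open>p\<close> and \<open>q\<close> preserves the ratio, the product,
  coprimality and the divisibility condition, so the denominator may be taken positive.\<close>

lemma corr_lim_rational:
  fixes p q :: int
  assumes "y \<noteq> 0" "p \<noteq> 0" "q \<noteq> 0" "coprime p q" "x / y = real_of_int p / real_of_int q"
  shows "\<exists>E E'. corr_lim x y 0 E \<and> corr_lim x y (1/4) E' \<and>
    E + E' = (if odd p \<and> odd q \<and> 4 dvd (q - p) then 2 / (real_of_int p * real_of_int q) else 0)"
proof (cases "q > 0")
  case True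
  then show ?thesis using corr_lim_rational_pos assms by blast
next
  case False
  have "4 dvd (- q - - p) \<longleftrightarrow> 4 dvd (q - p)"
    using dvd_minus_iff[of 4 "q - p"] by simp
  moreover have "odd (- p) \<longleftrightarrow> odd p" "odd (- q) \<longleftrightarrow> odd q"
    "real_of_int (- p) * real_of_int (- q) = real_of_int p * real_of_int q" by simp_all
  moreover have "y \<noteq> 0" "- p \<noteq> 0" "- q > 0" "coprime (- p) (- q)" "x / y = real_of_int (- p) / real_of_int (- q)"
    using False assms by simp_all
  from corr_lim_rational_pos[OF this] show ?thesis unfolding calculation .
qed

section \<open>Signs under a vanishing remainder\<close>

text \<open>A remainder below \<open>\<eta>\<close> can change the sign of the cosine only where its
  absolute value is at most \<open>\<eta>\<close>. The sequence \<open>d\<close> majorises the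
  indicator of these indices and has a small mean.\<close>

lemma cos_zeros_rare:
  assumes "equidistributed_mod1 u" and "\<epsilon> > 0"
  shows "\<exists>\<eta> d D. \<eta> > 0 \<and> cesaro_lim d D \<and> D \<le> \<epsilon> \<and> (\<forall>n. 0 \<le> d n) \<and>
    (\<forall>n. \<bar>cos (2 * pi * (u n - \<theta>))\<bar> \<le> \<eta> \<longrightarrow> 1 \<le> d n)"
proof -
  \<comment> \<open>\<open>2/(1 + k cos\<^sup>2)\<close> is a continuous majorant of the indicator of \<open>|cos| \<le> 1/\<surd>k\<close>\<close>
  let ?c = "\<lambda>t. cos (2 * pi * (t - \<theta>))"
  define F where "F k t = 2 / (1 + real k * (?c t)\<^sup>2)" for k :: nat and t
  have den: "1 + real k * (?c t)\<^sup>2 \<ge> 1" for k t by simp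
  have F_bds: "0 \<le> F k t" "F k t \<le> 2" for k t
  proof -
    have "0 < 1 + real k * (?c t)\<^sup>2" using den[of k t] by linarith
    then show "0 \<le> F k t" "F k t \<le> 2" using den[of k t] unfolding F_def
      by (simp_all only: pos_divide_le_eq) simp_all
  qed
  have cont: "isCont (F k) t" for k t
  proof -
    have "1 + real k * (?c t)\<^sup>2 \<noteq> 0" using den[of k t] by linarith
    then show ?thesis unfolding F_def by (intro continuous_intros)
  qed
  have cl: "cesaro_lim (\<lambda>n. F k (u n)) (integral {0..1} (F k))" for k
  proof -
    have "cesaro_lim (\<lambda>n. F k (frac (u n))) (integral {0..1} (F k))"
    proof (rule equidistributed_cesaro_lim)
      show "equidistributed (\<lambda>n. frac (u n))" using assms(1) by (simp add: equidistributed_mod1_def)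
      show "\<bar>F k t\<bar> \<le> 2" for t using F_bds[of k t] by simp
      show "{t. \<not> isCont (F k) t} \<in> null_sets lborel" using cont by simp
      show "F k \<in> borel_measurable borel" unfolding F_def by measurable
    qed
    moreover have "F k (frac t) = F k t" for t using cos_frac[of 1 t \<theta> 0] by (simp add: F_def)
    ultimately show ?thesis by simp
  qed
  define G where "G t = (if ?c t = 0 then 2 else 0 :: real)" for t
  \<comment> \<open>As \<open>k\<close> grows, the majorants tend to 2 at the zeros of the cosine
    and to 0 elsewhere. The zeros are negligible, so dominated convergence makes the means
    vanish.\<close>
  have "(\<lambda>k. integral {0..1} (F k)) \<longlonglongrightarrow> integral {0..1} G"
  proof (rule dominated_convergence(2)[where h = "\<lambda>_. 2"])
    show "F k integrable_on {0..1}" for k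
      by (intro integrable_continuous_real continuous_at_imp_continuous_on ballI cont)
    show "(\<lambda>k. F k t) \<longlonglongrightarrow> G t" if "t \<in> {0..1}" for t
    proof (cases "?c t = 0")
      case False
      then have c: "(?c t)\<^sup>2 > 0" by simp
      have "(\<lambda>k. 2 / (1 + real k * (?c t)\<^sup>2)) \<longlonglongrightarrow> 0"
        by (intro tendsto_divide_0[OF tendsto_const] filterlim_at_top_imp_at_infinity
          filterlim_tendsto_add_at_top[OF tendsto_const]
          filterlim_at_top_mult_tendsto_pos[OF tendsto_const c] filterlim_real_sequentially)
      then show ?thesis using False by (simp add: F_def G_def)
    qed (simp add: F_def G_def)
  qed (use F_bds in auto)
  also have "integral {0..1} G = 0"
  proof (rule integral_unique, rule has_integral_spike)
    show "negligible {t. ?c t = 0}"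
      using countable_imp_null_set_lborel[OF countable_cos_zeros[of \<theta>]]
      by (simp add: negligible_iff_null_sets null_sets_completionI)
    show "((\<lambda>_. 0) has_integral (0 :: real)) {0..1 :: real}" by simp
  qed (simp add: G_def)
  finally have "(\<lambda>k. integral {0..1} (F k)) \<longlonglongrightarrow> 0" .
  then have "\<forall>\<^sub>F k in sequentially. integral {0..1} (F k) < \<epsilon>"
    using \<open>\<epsilon> > 0\<close> by (rule order_tendstoD(2))
  then have "\<forall>\<^sub>F k in sequentially. integral {0..1} (F k) < \<epsilon> \<and> k > 0"
    using eventually_gt_at_top[of 0] by eventually_elim simp
  then obtain k where k: "integral {0..1} (F k) < \<epsilon>" "k > 0" by (auto simp: eventually_sequentially)
  \<comment> \<open>At this threshold the denominator of \<open>F k\<close> is at most 2, and the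
    numerator 2 makes the quotient at least 1.\<close>
  define \<eta> where "\<eta> = 1 / sqrt (real k)"
  have "1 \<le> F k t" if "\<bar>?c t\<bar> \<le> \<eta>" for t
  proof -
    have "\<bar>?c t\<bar>\<^sup>2 \<le> \<eta>\<^sup>2" using that by (intro power_mono) auto
    then have "real k * (?c t)\<^sup>2 \<le> 1" using k(2) by (simp add: \<eta>_def power_divide field_simps)
    moreover have "0 < 1 + real k * (?c t)\<^sup>2" using den[of k t] by linarith
    ultimately show ?thesis unfolding F_def by (simp add: pos_le_divide_eq)
  qed
  then show ?thesis using k F_bds cl[of k]
    by (intro exI[of _ \<eta>] exI[of _ "\<lambda>n. F k (u n)"] exI[of _ "integral {0..1} (F k)"]) (auto simp: \<eta>_def)
qed

text \<open>Where neither cosine vanishes, the product of the square waves is 1 or -1 according to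
  whether the signs agree, so \<open>(1 + product) / 2\<close> is the indicator of agreement. At
  indices where a remainder could interfere, both quantities lie in [0,1], and \<open>d + d'\<close>
  covers their difference.\<close>

lemma sign_agreement:
  fixes u v r r' :: "nat \<Rightarrow> real"
  assumes E: "cesaro_lim (\<lambda>n. sqw (u n - \<theta>) * sqw (v n - \<theta>)) E"
    and equi: "equidistributed_mod1 u" "equidistributed_mod1 v"
    and r: "r \<longlonglongrightarrow> 0" "r' \<longlonglongrightarrow> 0"
  shows "cesaro_lim (\<lambda>n. of_bool (sgn (cos (2 * pi * (u n - \<theta>)) + r n) = sgn (cos (2 * pi * (v n - \<theta>)) + r' n))) ((1 + E) / 2)"
proof (rule cesaro_lim_approx)
  fix \<epsilon> :: real assume "\<epsilon> > 0"
  then have "\<epsilon> / 2 > 0" by simp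
  obtain \<eta> d D where 1: "\<eta> > 0" "cesaro_lim d D" "D \<le> \<epsilon> / 2" "\<And>n. 0 \<le> d n"
    "\<And>n. \<bar>cos (2 * pi * (u n - \<theta>))\<bar> \<le> \<eta> \<Longrightarrow> 1 \<le> d n"
    using cos_zeros_rare[OF equi(1) \<open>\<epsilon> / 2 > 0\<close>] by metis
  obtain \<eta>' d' D' where 2: "\<eta>' > 0" "cesaro_lim d' D'" "D' \<le> \<epsilon> / 2" "\<And>n. 0 \<le> d' n"
    "\<And>n. \<bar>cos (2 * pi * (v n - \<theta>))\<bar> \<le> \<eta>' \<Longrightarrow> 1 \<le> d' n"
    using cos_zeros_rare[OF equi(2) \<open>\<epsilon> / 2 > 0\<close>] by metis
  let ?g = "\<lambda>n. of_bool (sgn (cos (2 * pi * (u n - \<theta>)) + r n) = sgn (cos (2 * pi * (v n - \<theta>)) + r' n)) :: real"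
  let ?f = "\<lambda>n. 1 / 2 * (1 + sqw (u n - \<theta>) * sqw (v n - \<theta>))"
  have "\<forall>\<^sub>F n in sequentially. \<bar>r n\<bar> < \<eta>" "\<forall>\<^sub>F n in sequentially. \<bar>r' n\<bar> < \<eta>'"
    using r 1(1) 2(1) unfolding tendsto_iff dist_real_def by simp_all
  then have "\<forall>\<^sub>F n in sequentially. \<bar>?g n - ?f n\<bar> \<le> d n + d' n"
  proof eventually_elim
    case (elim n)
    have sgn: "sgn (c + s) = sgn c" if "\<bar>c\<bar> > h" "\<bar>s\<bar> < h" for c s h :: real
      using that by (auto simp: sgn_real_def)
    show ?case
    proof (cases "\<bar>cos (2 * pi * (u n - \<theta>))\<bar> \<le> \<eta> \<or> \<bar>cos (2 * pi * (v n - \<theta>))\<bar> \<le> \<eta>'")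
      case True
      have "\<bar>sqw (u n - \<theta>) * sqw (v n - \<theta>)\<bar> \<le> 1 * 1"
        unfolding abs_mult by (intro mult_mono abs_sqw_le) auto
      then have "\<bar>?g n - ?f n\<bar> \<le> 1" by (auto simp: abs_le_iff)
      also have "1 \<le> d n + d' n" using True 1(4,5)[of n] 2(4,5)[of n] by force
      finally show ?thesis .
    next
      case False
      then have "cos (2 * pi * (u n - \<theta>)) \<noteq> 0" "cos (2 * pi * (v n - \<theta>)) \<noteq> 0" using 1(1) 2(1) by auto
      moreover have "?g n = of_bool (sqw (u n - \<theta>) = sqw (v n - \<theta>))"
        using sgn[of \<eta> "cos (2 * pi * (u n - \<theta>))" "r n"] sgn[of \<eta>' "cos (2 * pi * (v n - \<theta>))" "r' n"]
          False elim unfolding sqw_def by simp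
      ultimately have "?g n = ?f n" by (auto simp: sqw_def sgn_real_def)
      then have "\<bar>?g n - ?f n\<bar> = 0" by (simp only: diff_self abs_zero)
      then show ?thesis using 1(4)[of n] 2(4)[of n] by linarith
    qed
  qed
  moreover have "cesaro_lim ?f (1 / 2 * (1 + E))"
    by (intro cesaro_lim_cmult cesaro_lim_add cesaro_lim_const E)
  moreover have "cesaro_lim (\<lambda>n. d n + d' n) (D + D')" using 1 2 by (intro cesaro_lim_add)
  ultimately show "\<exists>f d c' D. cesaro_lim f c' \<and> cesaro_lim d D \<and>
    (\<forall>\<^sub>F n in sequentially. \<bar>?g n - f n\<bar> \<le> d n) \<and> \<bar>c' - (1 + E) / 2\<bar> \<le> \<epsilon> \<and> D \<le> \<epsilon>"
    using 1(3) 2(3) \<open>\<epsilon> > 0\<close>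
    by (intro exI[of _ ?f] exI[of _ "\<lambda>n. d n + d' n"] exI[of _ "1 / 2 * (1 + E)"] exI[of _ "D + D'"]) auto
qed

section \<open>The eigenvalue equation at high frequency\<close>

lemma continuous_mult_absolutely_integrable:
  fixes f h :: "real \<Rightarrow> real"
  assumes "continuous_on {a..b} f" "h absolutely_integrable_on {a..b}"
  shows "(\<lambda>x. f x * h x) absolutely_integrable_on {a..b}"
proof (rule absolutely_integrable_bounded_measurable_product_real)
  show "f \<in> borel_measurable (lebesgue_on {a..b})"
    by (rule continuous_imp_measurable_on_sets_lebesgue[OF assms(1)]) simp
  show "bounded (f ` {a..b})"
    by (intro compact_imp_bounded compact_continuous_image assms) simp
qed (use assms in auto)

text \<open>Here \<open>g\<close> is merely an indefinite integral, so its derivative exists only almost everywhere.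
  With \<open>H\<close> the indefinite integral of \<open>|h|\<close>, the defect \<open>D\<close> of the product rule satisfies
  \<open>|D z - D y| \<le> 2B |z - y| |H z - H y|\<close>, so \<open>D\<close> has derivative \<open>0\<close> everywhere.\<close>

lemma has_integral_product_rule:
  fixes g h \<phi> \<phi>' :: "real \<Rightarrow> real"
  assumes "a \<le> b" and h: "h absolutely_integrable_on {a..b}"
    and g: "\<And>x. x \<in> {a..b} \<Longrightarrow> g x = g a + integral {a..x} h"
    and \<phi>: "\<And>x. x \<in> {a..b} \<Longrightarrow> (\<phi> has_real_derivative \<phi>' x) (at x within {a..b})"
    and \<phi>': "continuous_on {a..b} \<phi>'"
  shows "((\<lambda>x. \<phi> x * h x + \<phi>' x * g x) has_integral (\<phi> b * g b - \<phi> a * g a)) {a..b}"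
proof -
  let ?S = "{a..b}"
  let ?k = "\<lambda>x. \<phi> x * h x + \<phi>' x * g x"
  have abs_h: "(\<lambda>x. \<bar>h x\<bar>) integrable_on ?S" and int_h: "h integrable_on ?S"
    using h by (auto simp: absolutely_integrable_on_def)
  have cont_\<phi>: "continuous_on ?S \<phi>"
    using \<phi> by (meson DERIV_continuous continuous_on_eq_continuous_within)
  have cont_g: "continuous_on ?S g"
    using indefinite_integral_continuous_1[OF int_h]
    by (subst continuous_on_cong[OF refl g]) (auto intro!: continuous_intros)
  define H where "H x = integral {a..x} (\<lambda>s. \<bar>h s\<bar>)" for x
  have cont_H: "continuous_on ?S H"
    unfolding H_def by (rule indefinite_integral_continuous_1[OF abs_h])
  have int_k: "?k integrable_on ?S"
    by (intro integrable_add set_lebesgue_integral_eq_integral(1) continuous_mult_absolutely_integrable h cont_\<phi>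
       integrable_continuous_real continuous_intros \<phi>' cont_g)
  have "\<exists>B. \<forall>x\<in>?S. \<bar>\<phi>' x\<bar> \<le> B"
    using compact_imp_bounded[OF compact_continuous_image[OF \<phi>' compact_Icc]]
    unfolding bounded_iff by auto
  then obtain B where B: "\<And>x. x \<in> ?S \<Longrightarrow> \<bar>\<phi>' x\<bar> \<le> B" by blast
  have "B \<ge> 0" using B[of a] \<open>a \<le> b\<close> by (meson abs_ge_zero atLeastAtMost_iff order.refl order.trans)
  define D where "D x = \<phi> x * g x - integral {a..x} ?k" for x
  have sub: "f integrable_on {y..z}" if "f integrable_on ?S" "a \<le> y" "z \<le> b" for f :: "real \<Rightarrow> real" and y z
    using integrable_subinterval_real[OF that(1), of y z] that by auto
  have split: "integral {a..z} f - integral {a..y} f = integral {y..z} f"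
    if "f integrable_on ?S" "a \<le> y" "y \<le> z" "z \<le> b" for f :: "real \<Rightarrow> real" and y z
    using Henstock_Kurzweil_Integration.integral_combine[of a y z f] sub[OF that(1), of a z] that by simp
  have g_diff: "\<bar>g z - g y\<bar> \<le> H z - H y" if "a \<le> y" "y \<le> z" "z \<le> b" for y z
  proof -
    have "g z - g y = integral {y..z} h"
      using g[of z] g[of y] split[OF int_h that] that by simp
    also have "norm \<dots> \<le> integral {y..z} (\<lambda>s. \<bar>h s\<bar>)"
      by (rule Henstock_Kurzweil_Integration.integral_norm_bound_integral) (use sub int_h abs_h that in auto)
    also have "\<dots> = H z - H y" unfolding H_def using split[OF abs_h that] by simp
    finally show ?thesis by simp
  qed
  have main: "\<bar>D z - D y\<bar> \<le> 2 * B * (z - y) * (H z - H y)" if yz: "a \<le> y" "y \<le> z" "z \<le> b" for y z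
  proof -
    have ss: "{y..z} \<subseteq> ?S" using yz by auto
    have h1: "(h has_integral (g z - g y)) {y..z}"
      using g[of z] g[of y] split[OF int_h yz] yz sub[OF int_h yz(1,3)] by (simp add: has_integral_integral)
    have p1: "(\<phi>' has_integral (\<phi> z - \<phi> y)) {y..z}"
      using yz ss by (intro fundamental_theorem_of_calculus)
        (auto simp flip: has_real_derivative_iff_has_vector_derivative intro: DERIV_subset[OF \<phi>])
    have "(?k has_integral (integral {a..z} ?k - integral {a..y} ?k)) {y..z}"
      unfolding split[OF int_k yz] by (rule integrable_integral[OF sub[OF int_k yz(1,3)]])
    \<comment> \<open>The increment of the product is split as
      \<open>\<phi> z * (g z - g y) + g y * (\<phi> z - \<phi> y)\<close>. With one factor frozen at
      an endpoint in each term, the integrand of the defect contains only increments of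
      \<open>\<phi>\<close> and \<open>g\<close>.\<close>
    from has_integral_diff[OF has_integral_add[OF has_integral_mult_right[OF h1, of "\<phi> z"] has_integral_mult_right[OF p1, of "g y"]] this]
    have hi: "((\<lambda>s. (\<phi> z - \<phi> s) * h s + \<phi>' s * (g y - g s)) has_integral (D z - D y)) {y..z}"
      by (simp add: D_def algebra_simps)
    have "((\<lambda>s. \<bar>h s\<bar>) has_integral (H z - H y)) {y..z}"
      unfolding H_def split[OF abs_h yz] by (rule integrable_integral[OF sub[OF abs_h yz(1,3)]])
    from has_integral_add[OF has_integral_mult_right[OF this, of "B * (z - y)"] has_integral_const_real[of "B * (H z - H y)" y z]]
    have hb: "((\<lambda>s. B * (z - y) * \<bar>h s\<bar> + B * (H z - H y)) has_integral (2 * B * (z - y) * (H z - H y))) {y..z}"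
      using yz by (simp add: algebra_simps)
    have H_mono: "H s \<le> H z" if "s \<in> {y..z}" for s
      using g_diff[of s z] that yz by auto
    have "norm ((\<phi> z - \<phi> s) * h s + \<phi>' s * (g y - g s)) \<le> B * (z - y) * \<bar>h s\<bar> + B * (H z - H y)" if s: "s \<in> {y..z}" for s
    proof -
      have "\<bar>\<phi> z - \<phi> s\<bar> \<le> B * \<bar>z - s\<bar>"
        using field_differentiable_bound[of ?S \<phi> \<phi>' B z s] \<phi> B s yz by (auto simp: convex_real_interval)
      also have "\<dots> \<le> B * (z - y)" using s \<open>B \<ge> 0\<close> by (intro mult_left_mono) auto
      finally have 1: "\<bar>\<phi> z - \<phi> s\<bar> \<le> B * (z - y)" .
      have 2: "\<bar>g y - g s\<bar> \<le> H z - H y" using g_diff[of y s] H_mono[OF s] s yz by auto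
      have "norm ((\<phi> z - \<phi> s) * h s + \<phi>' s * (g y - g s)) \<le> \<bar>\<phi> z - \<phi> s\<bar> * \<bar>h s\<bar> + \<bar>\<phi>' s\<bar> * \<bar>g y - g s\<bar>"
        unfolding real_norm_def abs_mult[symmetric] by (rule abs_triangle_ineq)
      also have "\<dots> \<le> B * (z - y) * \<bar>h s\<bar> + B * (H z - H y)"
        using 1 2 B[of s] ss s \<open>B \<ge> 0\<close> by (intro add_mono mult_mono) auto
      finally show ?thesis .
    qed
    from Henstock_Kurzweil_Integration.integral_norm_bound_integral[OF has_integral_integrable[OF hi] has_integral_integrable[OF hb] this]
    show ?thesis using integral_unique[OF hi] integral_unique[OF hb] by simp
  qed
  have "(D has_real_derivative 0) (at y within ?S)" if y: "y \<in> ?S" for y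
    unfolding has_field_derivative_iff
  proof (rule Lim_null_comparison)
    show "\<forall>\<^sub>F z in at y within ?S. norm ((D z - D y) / (z - y)) \<le> 2 * B * \<bar>H z - H y\<bar>"
      unfolding eventually_at_filter
    proof (intro always_eventually allI impI)
      fix z assume z: "z \<noteq> y" "z \<in> ?S"
      have "\<bar>D z - D y\<bar> \<le> 2 * B * \<bar>H z - H y\<bar> * \<bar>z - y\<bar>"
      proof (cases "y \<le> z")
        case True
        have "\<bar>D z - D y\<bar> \<le> 2 * B * (z - y) * (H z - H y)"
          using main True y z by simp
        also have "\<dots> \<le> 2 * B * (z - y) * \<bar>H z - H y\<bar>"
          using True \<open>B \<ge> 0\<close> by (intro mult_left_mono) auto
        also have "\<dots> = 2 * B * \<bar>H z - H y\<bar> * \<bar>z - y\<bar>" using True by simp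
        finally show ?thesis .
      next
        case False
        have "\<bar>D z - D y\<bar> \<le> 2 * B * (y - z) * (H y - H z)"
          using main[of z y] False y z by (simp add: abs_minus_commute)
        also have "\<dots> \<le> 2 * B * (y - z) * \<bar>H z - H y\<bar>"
          using False \<open>B \<ge> 0\<close> by (intro mult_left_mono) auto
        also have "\<dots> = 2 * B * \<bar>H z - H y\<bar> * \<bar>z - y\<bar>" using False by simp
        finally show ?thesis .
      qed
      then show "norm ((D z - D y) / (z - y)) \<le> 2 * B * \<bar>H z - H y\<bar>"
        using z by (simp add: abs_divide divide_le_eq)
    qed
    have "(H \<longlongrightarrow> H y) (at y within ?S)" using cont_H y by (simp add: continuous_on_def)
    then have "((\<lambda>z. 2 * B * \<bar>H z - H y\<bar>) \<longlongrightarrow> 2 * B * \<bar>H y - H y\<bar>) (at y within ?S)"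
      by (intro tendsto_intros)
    then show "((\<lambda>z. 2 * B * \<bar>H z - H y\<bar>) \<longlongrightarrow> 0) (at y within ?S)" by simp
  qed
  then obtain c where "\<And>x. x \<in> ?S \<Longrightarrow> D x = c"
    using has_field_derivative_zero_constant[of ?S D] by (auto simp: convex_real_interval)
  then have "D b = D a" using \<open>a \<le> b\<close> by simp
  then have "integral ?S ?k = \<phi> b * g b - \<phi> a * g a" by (simp add: D_def)
  then show ?thesis using int_k by (metis integrable_integral)
qed

text \<open>Testing the equation against cos and sin and integrating by parts gives
  \<open>Ic\<close> and \<open>Is\<close>, whose combination is the Volterra integral with kernel
  sin(\<omega>(x - s)). Bounding the two integrals separately costs the factor 2.\<close>

lemma variation_of_parameters:
  fixes w w' w'' q :: "real \<Rightarrow> real"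
  assumes "0 \<le> x" "\<omega> > 0"
    and w: "\<And>s. s \<in> {0..x} \<Longrightarrow> (w has_real_derivative w' s) (at s within {0..x})"
    and w'': "w'' absolutely_integrable_on {0..x}"
    and w': "\<And>s. s \<in> {0..x} \<Longrightarrow> w' s = w' 0 + integral {0..s} w''"
    and q: "q absolutely_integrable_on {0..x}"
    and N: "negligible N" and eq: "\<And>s. s \<notin> N \<Longrightarrow> w'' s + \<omega>\<^sup>2 * w s = q s * w s"
  shows "\<bar>w x - (w 0 * cos (\<omega> * x) + w' 0 / \<omega> * sin (\<omega> * x))\<bar> \<le> 2 / \<omega> * integral {0..x} (\<lambda>s. \<bar>q s\<bar> * \<bar>w s\<bar>)"
proof -
  let ?S = "{0..x}"
  define J where "J = integral ?S (\<lambda>s. \<bar>q s\<bar> * \<bar>w s\<bar>)"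
  have cont_w: "continuous_on ?S w"
    using w by (meson DERIV_continuous continuous_on_eq_continuous_within)
  have qw: "(\<lambda>s. w s * q s) absolutely_integrable_on ?S"
    by (rule continuous_mult_absolutely_integrable[OF cont_w q])
  then have int_qw: "(\<lambda>s. \<bar>q s\<bar> * \<bar>w s\<bar>) integrable_on ?S"
    by (simp add: absolutely_integrable_on_def abs_mult mult.commute)
  have bound: "\<bar>I\<bar> \<le> J"
    if "((\<lambda>s. c s * (w'' s + \<omega>\<^sup>2 * w s)) has_integral I) ?S" "\<And>s. \<bar>c s\<bar> \<le> 1" for c I
  proof -
    have hi: "((\<lambda>s. c s * (q s * w s)) has_integral I) ?S"
      by (rule has_integral_spike[OF N _ that(1)]) (use eq in auto)
    have "norm (integral ?S (\<lambda>s. c s * (q s * w s))) \<le> J"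
      unfolding J_def
    proof (rule Henstock_Kurzweil_Integration.integral_norm_bound_integral[OF has_integral_integrable[OF hi] int_qw])
      fix s
      have "\<bar>c s\<bar> * (\<bar>q s\<bar> * \<bar>w s\<bar>) \<le> 1 * (\<bar>q s\<bar> * \<bar>w s\<bar>)"
        by (intro mult_right_mono that) auto
      then show "norm (c s * (q s * w s)) \<le> \<bar>q s\<bar> * \<bar>w s\<bar>" by (simp add: abs_mult)
    qed
    then show ?thesis using integral_unique[OF hi] by simp
  qed
  \<comment> \<open>Integration by parts is done twice. The terms with \<open>w''\<close> need the
    product rule for indefinite integrals, since \<open>w'\<close> need not be differentiable
    everywhere; those with \<open>w'\<close> and \<open>w\<close> are classical.\<close>
  have ftc: "((\<lambda>s. \<phi> s * w' s + \<phi>' s * w s) has_integral (\<phi> x * w x - \<phi> 0 * w 0)) ?S"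
    if "\<And>s. (\<phi> has_real_derivative \<phi>' s) (at s)" for \<phi> \<phi>'
    using \<open>0 \<le> x\<close> w that
    by (intro fundamental_theorem_of_calculus)
      (auto simp flip: has_real_derivative_iff_has_vector_derivative intro!: derivative_eq_intros DERIV_subset[OF that])
  note prod = has_integral_product_rule[OF \<open>0 \<le> x\<close> w'' w']
  define Ic where "Ic = w' x * cos (\<omega> * x) + \<omega> * w x * sin (\<omega> * x) - w' 0"
  define Is where "Is = w' x * sin (\<omega> * x) - \<omega> * w x * cos (\<omega> * x) + \<omega> * w 0"
  have c1: "((\<lambda>s. cos (\<omega> * s) * w'' s + (- \<omega> * sin (\<omega> * s)) * w' s) has_integral (cos (\<omega> * x) * w' x - cos (\<omega> * 0) * w' 0)) ?S"
    by (rule prod) (auto intro!: derivative_eq_intros continuous_intros)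
  have c2: "((\<lambda>s. \<omega> * sin (\<omega> * s) * w' s + \<omega>\<^sup>2 * cos (\<omega> * s) * w s) has_integral (\<omega> * sin (\<omega> * x) * w x - \<omega> * sin (\<omega> * 0) * w 0)) ?S"
    by (rule ftc) (auto intro!: derivative_eq_intros simp: power2_eq_square)
  from has_integral_add[OF c1 c2] 
  have "((\<lambda>s. cos (\<omega> * s) * (w'' s + \<omega>\<^sup>2 * w s)) has_integral Ic) ?S"
    by (simp add: Ic_def algebra_simps)
  then have Ic: "\<bar>Ic\<bar> \<le> J" by (rule bound) simp
  have s1: "((\<lambda>s. sin (\<omega> * s) * w'' s + \<omega> * cos (\<omega> * s) * w' s) has_integral (sin (\<omega> * x) * w' x - sin (\<omega> * 0) * w' 0)) ?S"
    by (rule prod) (auto intro!: derivative_eq_intros continuous_intros)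
  have s2: "((\<lambda>s. \<omega> * cos (\<omega> * s) * w' s + (- \<omega>\<^sup>2 * sin (\<omega> * s)) * w s) has_integral (\<omega> * cos (\<omega> * x) * w x - \<omega> * cos (\<omega> * 0) * w 0)) ?S"
    by (rule ftc) (auto intro!: derivative_eq_intros simp: power2_eq_square)
  from has_integral_diff[OF s1 s2] 
  have "((\<lambda>s. sin (\<omega> * s) * (w'' s + \<omega>\<^sup>2 * w s)) has_integral Is) ?S"
    by (simp add: Is_def algebra_simps)
  then have Is: "\<bar>Is\<bar> \<le> J" by (rule bound) simp
  \<comment> \<open>This combination eliminates the unknown slope \<open>w' x\<close>; the identity
    sin^2 + cos^2 = 1 then isolates \<open>\<omega> * w x\<close>.\<close>
  have "S * (a * C + b * S - d) - C * (a * S - b * C + e) = b * (S\<^sup>2 + C\<^sup>2) - (e * C + d * S)"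
    for a b C S d e :: real by (simp add: algebra_simps power2_eq_square)
  from this[of "sin (\<omega> * x)" "w' x" "cos (\<omega> * x)" "\<omega> * w x" "w' 0" "\<omega> * w 0"]
  have "sin (\<omega> * x) * Ic - cos (\<omega> * x) * Is = \<omega> * w x - (\<omega> * w 0 * cos (\<omega> * x) + w' 0 * sin (\<omega> * x))"
    unfolding Ic_def Is_def by simp
  then have e: "w x - (w 0 * cos (\<omega> * x) + w' 0 / \<omega> * sin (\<omega> * x)) = (sin (\<omega> * x) * Ic - cos (\<omega> * x) * Is) / \<omega>"
    using \<open>\<omega> > 0\<close> by (simp add: field_simps)
  have "\<bar>sin (\<omega> * x) * Ic - cos (\<omega> * x) * Is\<bar> \<le> \<bar>sin (\<omega> * x)\<bar> * \<bar>Ic\<bar> + \<bar>cos (\<omega> * x)\<bar> * \<bar>Is\<bar>"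
    unfolding abs_mult[symmetric] by (rule abs_triangle_ineq4)
  also have "\<dots> \<le> 1 * J + 1 * J"
    by (intro add_mono mult_mono Ic Is) auto
  finally show ?thesis unfolding e J_def[symmetric] using \<open>\<omega> > 0\<close>
    by (simp add: abs_divide divide_right_mono)
qed

text \<open>If \<open>\<omega>\<close> is large, the maximum of \<open>|w|\<close> on \<open>[0,R]\<close> is at most \<open>A\<close> plus half of itself,
  hence at most \<open>2A\<close>.\<close>

lemma large_frequency_bound:
  fixes w w' w'' q :: "real \<Rightarrow> real"
  assumes "\<omega> > 0"
    and w: "\<And>s. s \<in> {0..R} \<Longrightarrow> (w has_real_derivative w' s) (at s within {0..R})"
    and w'': "w'' absolutely_integrable_on {0..R}"
    and w': "\<And>s. s \<in> {0..R} \<Longrightarrow> w' s = w' 0 + integral {0..s} w''"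
    and q: "q absolutely_integrable_on {0..R}"
    and N: "negligible N" "\<And>s. s \<notin> N \<Longrightarrow> w'' s + \<omega>\<^sup>2 * w s = q s * w s"
    and A: "\<And>s. \<bar>w 0 * cos (\<omega> * s) + w' 0 / \<omega> * sin (\<omega> * s)\<bar> \<le> A"
    and large: "4 * integral {0..R} (\<lambda>s. \<bar>q s\<bar>) \<le> \<omega>"
    and x: "x \<in> {0..R}"
  shows "\<bar>w x - (w 0 * cos (\<omega> * x) + w' 0 / \<omega> * sin (\<omega> * x))\<bar> \<le> 4 * integral {0..R} (\<lambda>s. \<bar>q s\<bar>) / \<omega> * A"
proof -
  define L where "L = integral {0..R} (\<lambda>s. \<bar>q s\<bar>)"
  have abs_q: "(\<lambda>s. \<bar>q s\<bar>) integrable_on {0..R}" using q by (simp add: absolutely_integrable_on_def)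
  have "L \<ge> 0" unfolding L_def by (rule integral_nonneg[OF abs_q]) simp
  have cont_w: "continuous_on {0..R} w"
    using w by (meson DERIV_continuous continuous_on_eq_continuous_within)
  then have "continuous_on {0..R} (\<lambda>s. \<bar>w s\<bar>)" by (intro continuous_intros)
  then have "\<exists>z\<in>{0..R}. \<forall>s\<in>{0..R}. \<bar>w s\<bar> \<le> \<bar>w z\<bar>"
    using x by (intro continuous_attains_sup) auto
  then obtain z where z: "z \<in> {0..R}" "\<And>s. s \<in> {0..R} \<Longrightarrow> \<bar>w s\<bar> \<le> \<bar>w z\<bar>" by blast
  have err: "\<bar>w y - (w 0 * cos (\<omega> * y) + w' 0 / \<omega> * sin (\<omega> * y))\<bar> \<le> 2 / \<omega> * (\<bar>w z\<bar> * L)"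
    if y: "y \<in> {0..R}" for y
  proof -
    have sub: "{0..y} \<subseteq> {0..R}" using y by auto
    have "\<bar>w y - (w 0 * cos (\<omega> * y) + w' 0 / \<omega> * sin (\<omega> * y))\<bar> \<le> 2 / \<omega> * integral {0..y} (\<lambda>s. \<bar>q s\<bar> * \<bar>w s\<bar>)"
      using y sub
      by (intro variation_of_parameters[OF _ \<open>\<omega> > 0\<close> _ _ _ _ N, where w' = w'])
        (auto intro: DERIV_subset[OF w] w' absolutely_integrable_on_subinterval[OF q] absolutely_integrable_on_subinterval[OF w''])
    also have "\<dots> \<le> 2 / \<omega> * (\<bar>w z\<bar> * L)"
    proof (rule mult_left_mono)
      have int: "(\<lambda>s. \<bar>q s\<bar> * \<bar>w s\<bar>) integrable_on {0..R}"
        using continuous_mult_absolutely_integrable[OF cont_w q]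
        by (simp add: absolutely_integrable_on_def abs_mult mult.commute)
      have "integral {0..y} (\<lambda>s. \<bar>q s\<bar> * \<bar>w s\<bar>) \<le> integral {0..R} (\<lambda>s. \<bar>q s\<bar> * \<bar>w s\<bar>)"
        by (rule integral_subset_le[OF sub]) (use int integrable_on_subinterval[OF int sub] in auto)
      also have "\<dots> \<le> integral {0..R} (\<lambda>s. \<bar>w z\<bar> * \<bar>q s\<bar>)"
      proof (rule integral_le[OF int])
        show "(\<lambda>s. \<bar>w z\<bar> * \<bar>q s\<bar>) integrable_on {0..R}"
          using integrable_on_cmult_left[OF abs_q, of "\<bar>w z\<bar>"] by simp
      qed (use z(2) in \<open>auto simp: mult.commute[of "\<bar>w z\<bar>"] intro!: mult_left_mono\<close>)
      finally show "integral {0..y} (\<lambda>s. \<bar>q s\<bar> * \<bar>w s\<bar>) \<le> \<bar>w z\<bar> * L" by (simp add: L_def)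
    qed (use \<open>\<omega> > 0\<close> in simp)
    finally show ?thesis .
  qed
  \<comment> \<open>The 4 in the largeness condition is the 2 of the error bound times the 2 needed
    to absorb half of the maximum.\<close>
  have "2 / \<omega> * (\<bar>w z\<bar> * L) \<le> \<bar>w z\<bar> / 2"
  proof -
    have "\<bar>w z\<bar> * (4 * L) \<le> \<bar>w z\<bar> * \<omega>" using large by (intro mult_left_mono) (auto simp: L_def)
    then show ?thesis using \<open>\<omega> > 0\<close> by (simp add: field_simps)
  qed
  then have "\<bar>w z\<bar> \<le> 2 * A" using err[OF z(1)] A[of z] by linarith
  have "\<bar>w x - (w 0 * cos (\<omega> * x) + w' 0 / \<omega> * sin (\<omega> * x))\<bar> \<le> 2 / \<omega> * (\<bar>w z\<bar> * L)"
    by (rule err[OF x])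
  also have "\<dots> \<le> 2 / \<omega> * (2 * A * L)"
    using \<open>\<bar>w z\<bar> \<le> 2 * A\<close> \<open>L \<ge> 0\<close> \<open>\<omega> > 0\<close> by (intro mult_left_mono mult_right_mono) auto
  finally show ?thesis by (simp add: L_def mult_ac)
qed

section \<open>From the operator to a relative remainder bound\<close>

lemma L1_loc_complex:
  assumes "g \<in> L1_loc"
  shows "(\<lambda>x. Re (g x)) absolutely_integrable_on {a..b}"
    and "integral {a..b} (\<lambda>x. Re (g x)) = Re (integral {a..b} g)"
proof -
  have g: "g absolutely_integrable_on {a..b}" using assms by (simp add: L1_loc_def)
  show "(\<lambda>x. Re (g x)) absolutely_integrable_on {a..b}"
    using absolutely_integrable_linear[OF g bounded_linear_Re] by (simp add: o_def)
  show "integral {a..b} (\<lambda>x. Re (g x)) = Re (integral {a..b} g)"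
    using integral_linear[OF set_lebesgue_integral_eq_integral(1)[OF g] bounded_linear_Re]
    by (simp add: o_def)
qed

text \<open>Taking real parts turns the complex derivatives into derivatives of the real
  \<open>w\<close>. The first one is an indefinite integral, hence continuous, so \<open>w\<close>
  is differentiable everywhere and its slope at 0 is meaningful. The second-order equation survives
  only off a negligible set.\<close>

lemma eigenfunction_ode:
  fixes w :: "real \<Rightarrow> real"
  assumes "schroedinger_eigenfunction V m (\<lambda>x. complex_of_real (w x))"
  obtains w' w'' N where
    "\<And>x. (w has_real_derivative w' x) (at x)"
    "\<And>R. w'' absolutely_integrable_on {0..R}"
    "\<And>s. s \<ge> 0 \<Longrightarrow> w' s = w' 0 + integral {0..s} w''"
    "negligible N" "\<And>s. s \<notin> N \<Longrightarrow> w'' s + 4 * pi\<^sup>2 * m * w s = 4 * pi\<^sup>2 * V s * w s"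
proof -
  obtain f' f'' where ac: "AC_loc_deriv (\<lambda>x. complex_of_real (w x)) f'" and ac': "AC_loc_deriv f' f''"
    and eq: "AE x in lebesgue. complex_of_real m * complex_of_real (w x) =
      - f'' x / (4 * of_real (pi\<^sup>2)) + of_real (V x) * complex_of_real (w x)"
    using assms unfolding schroedinger_eigenfunction_def schroedinger_def by blast
  define w' where "w' x = Re (f' x)" for x
  define w'' where "w'' x = Re (f'' x)" for x
  have w': "w b - w a = integral {a..b} w'" if "a \<le> b" for a b
  proof -
    have "complex_of_real (w b) - complex_of_real (w a) = integral {a..b} f'"
      using ac that unfolding AC_loc_deriv_def by blast
    from arg_cong[OF this, of Re] show ?thesis
      using L1_loc_complex(2)[of f' a b] ac by (simp add: AC_loc_deriv_def w'_def[abs_def])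
  qed
  have w'': "w' b - w' a = integral {a..b} w''" if "a \<le> b" for a b
  proof -
    have "f' b - f' a = integral {a..b} f''"
      using ac' that unfolding AC_loc_deriv_def by blast
    from arg_cong[OF this, of Re] show ?thesis
      using L1_loc_complex(2)[of f'' a b] ac' by (simp add: AC_loc_deriv_def w'_def w''_def[abs_def])
  qed
  have ai: "w'' absolutely_integrable_on {a..b}" for a b
    using L1_loc_complex(1)[of f'' a b] ac' by (simp add: AC_loc_deriv_def w''_def[abs_def])
  have cont: "continuous_on {a..b} w'" for a b
  proof -
    have "continuous_on {a..b} (\<lambda>x. w' a + integral {a..x} w'')"
      by (intro continuous_intros indefinite_integral_continuous_1 set_lebesgue_integral_eq_integral(1) ai)
    then show ?thesis
      by (rule continuous_on_eq) (use w''[of a] in force)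
  qed
  obtain N where N: "N \<in> null_sets lebesgue" "\<And>x. x \<notin> N \<Longrightarrow> complex_of_real m * complex_of_real (w x) =
      - f'' x / (4 * of_real (pi\<^sup>2)) + of_real (V x) * complex_of_real (w x)"
    using AE_E3[OF eq] by auto
  show thesis
  proof
    show "(w has_real_derivative w' x) (at x)" for x
    proof -
      have "((\<lambda>u. w (x - 1) + integral {x - 1..u} w') has_real_derivative w' x) (at x within {x - 1..x + 1})"
        by (auto intro!: derivative_eq_intros integral_has_real_derivative cont)
      then have "(w has_real_derivative w' x) (at x within {x - 1..x + 1})"
      proof (rule has_field_derivative_transform_within[where d = 1])
        show "w (x - 1) + integral {x - 1..u} w' = w u" if "u \<in> {x - 1..x + 1}" for u
          using w'[of "x - 1" u] that by simp
      qed auto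
      then show ?thesis by (simp add: at_within_Icc_at)
    qed
    show "w'' absolutely_integrable_on {0..R}" for R by (rule ai)
    show "w' s = w' 0 + integral {0..s} w''" if "s \<ge> 0" for s using w''[OF that] by simp
    show "negligible N" using N(1) by (simp add: negligible_iff_null_sets)
    show "w'' s + 4 * pi\<^sup>2 * m * w s = 4 * pi\<^sup>2 * V s * w s" if "s \<notin> N" for s
    proof -
      have "complex_of_real m * complex_of_real (w s) =
        - f'' s / complex_of_real (4 * pi\<^sup>2) + of_real (V s) * complex_of_real (w s)"
        using N(2)[OF that] by simp
      from arg_cong[OF this, of Re] have "m * w s = - w'' s / (4 * pi\<^sup>2) + V s * w s"
        unfolding w''_def by (simp only: Re_divide_of_real plus_complex.sel uminus_complex.sel
            flip: of_real_mult) simp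
      then show ?thesis by (simp add: field_simps)
    qed
  qed
qed

lemma deriv_even_0:
  fixes f :: "real \<Rightarrow> real"
  assumes "\<And>x. f (- x) = f x" "(f has_real_derivative d) (at 0)"
  shows "d = 0"
proof -
  have "((\<lambda>x. f (- x)) has_real_derivative d * (-1)) (at 0)"
    by (rule DERIV_chain'[where g = f]) (auto intro!: derivative_eq_intros assms(2))
  then have "(f has_real_derivative - d) (at 0)" using assms(1) by simp
  from DERIV_unique[OF assms(2) this] show ?thesis by simp
qed

lemma cos_even_phase: "cos (2 * pi * (t - real (2 * m) / 4)) = (-1) ^ m * cos (2 * pi * (t - 0))"
proof -
  have "2 * pi * (t - real (2 * m) / 4) = 2 * pi * (t - 0) - real m * pi" by (simp add: algebra_simps)
  then show ?thesis by (simp only: cos_diff cos_npi sin_npi) simp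
qed

lemma cos_odd_phase: "cos (2 * pi * (t - real (2 * m + 1) / 4)) = (-1) ^ m * cos (2 * pi * (t - 1 / 4))"
proof -
  have "2 * pi * (t - real (2 * m + 1) / 4) = 2 * pi * (t - 1 / 4) - real m * pi" by (simp add: field_simps)
  then show ?thesis by (simp only: cos_diff[of _ "real m * pi"] cos_npi sin_npi) simp
qed

text \<open>Parity kills either the slope or the value at 0, so the amplitude reduces to the
  absolute value of a single coefficient. The sign condition makes that coefficient nonzero and
  supplies the power of -1 that the phase \<open>n / 4\<close> produces.\<close>

lemma cosine_main_term:
  fixes f :: "real \<Rightarrow> real" and n :: nat
  assumes d: "(f has_real_derivative d) (at 0)" and "\<mu> > 0"
    and even: "even n \<Longrightarrow> (\<forall>x. f (- x) = f x) \<and> sgn (f 0) = (-1) ^ (n div 2)"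
    and odd: "odd n \<Longrightarrow> (\<forall>x. f (- x) = - f x) \<and> sgn d = (-1) ^ (n div 2)"
  shows "amplitude f \<mu> > 0"
    and "f 0 * cos (2 * pi * sqrt \<mu> * x) + d / (2 * pi * sqrt \<mu>) * sin (2 * pi * sqrt \<mu> * x) =
      amplitude f \<mu> * cos (2 * pi * (sqrt \<mu> * x - real n / 4))"
    and "if even n then d = 0 else f 0 = 0"
proof -
  have "deriv f 0 = d" using d by (rule DERIV_imp_deriv)
  then have A: "amplitude f \<mu> = sqrt ((f 0)\<^sup>2 + d\<^sup>2 / (4 * pi\<^sup>2 * \<mu>))" by (simp add: amplitude_def)
  have "amplitude f \<mu> > 0 \<and>
    f 0 * cos (2 * pi * sqrt \<mu> * x) + d / (2 * pi * sqrt \<mu>) * sin (2 * pi * sqrt \<mu> * x) =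
      amplitude f \<mu> * cos (2 * pi * (sqrt \<mu> * x - real n / 4)) \<and> (if even n then d = 0 else f 0 = 0)"
  proof (cases "even n")
    case True
    then obtain m where n: "n = 2 * m" by blast
    have "d = 0" using deriv_even_0[OF _ d] even[OF True] by blast
    then have A: "amplitude f \<mu> = \<bar>f 0\<bar>" using A by simp
    have s: "sgn (f 0) = (-1) ^ m" using even n by simp
    then have "f 0 \<noteq> 0" by auto
    have "f 0 = (-1) ^ m * \<bar>f 0\<bar>" using s by (metis sgn_mult_abs)
    then show ?thesis using \<open>d = 0\<close> \<open>f 0 \<noteq> 0\<close> True unfolding n cos_even_phase A by (simp add: mult_ac)
  next
    case False
    then obtain m where n: "n = 2 * m + 1" by (elim oddE)
    have "f (- 0) = - f 0" using odd[OF False] by blast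
    then have "f 0 = 0" by simp
    then have A: "amplitude f \<mu> = \<bar>d\<bar> / (2 * pi * sqrt \<mu>)"
      using A \<open>\<mu> > 0\<close> by (simp add: real_sqrt_divide real_sqrt_mult)
    have s: "sgn d = (-1) ^ m" using odd n by simp
    then have "d \<noteq> 0" by auto
    have "d = (-1) ^ m * \<bar>d\<bar>" using s by (metis sgn_mult_abs)
    moreover have "cos (2 * pi * (sqrt \<mu> * x - 1 / 4)) = sin (2 * pi * sqrt \<mu> * x)"
    proof -
      have "2 * pi * (sqrt \<mu> * x - 1 / 4) = 2 * pi * sqrt \<mu> * x - pi / 2" by (simp add: algebra_simps)
      then show ?thesis by (simp only: cos_diff) simp
    qed
    ultimately show ?thesis using \<open>f 0 = 0\<close> \<open>d \<noteq> 0\<close> \<open>\<mu> > 0\<close> False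
      unfolding n cos_odd_phase A by (simp add: mult_ac)
  qed
  then show "amplitude f \<mu> > 0"
    "f 0 * cos (2 * pi * sqrt \<mu> * x) + d / (2 * pi * sqrt \<mu>) * sin (2 * pi * sqrt \<mu> * x) =
      amplitude f \<mu> * cos (2 * pi * (sqrt \<mu> * x - real n / 4))"
    "if even n then d = 0 else f 0 = 0" by blast+
qed

text \<open>With frequency \<open>2 * pi * sqrt \<mu>\<close> the whole term
  \<open>4 * pi\<^sup>2 * V\<close> acts as the perturbation. The bound involves only
  \<open>V\<close>, \<open>R\<close> and \<open>\<mu>\<close>, which gives uniformity on compact
  sets and decay as the eigenvalue grows.\<close>

lemma remainder_bound:
  fixes f :: "real \<Rightarrow> real" and n :: nat
  assumes V: "V \<in> L1_loc" and eig: "schroedinger_eigenfunction V \<mu> (\<lambda>x. complex_of_real (f x))"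
    and "\<mu> > 0"
    and even: "even n \<Longrightarrow> (\<forall>x. f (- x) = f x) \<and> sgn (f 0) = (-1) ^ (n div 2)"
    and odd: "odd n \<Longrightarrow> (\<forall>x. f (- x) = - f x) \<and> sgn (deriv f 0) = (-1) ^ (n div 2)"
  shows "amplitude f \<mu> > 0"
    and "4 * integral {0..R} (\<lambda>s. \<bar>4 * pi\<^sup>2 * V s\<bar>) \<le> 2 * pi * sqrt \<mu> \<Longrightarrow> \<bar>x\<bar> \<le> R \<Longrightarrow>
      \<bar>f x / amplitude f \<mu> - cos (2 * pi * (sqrt \<mu> * x - real n / 4))\<bar> \<le>
        4 * integral {0..R} (\<lambda>s. \<bar>4 * pi\<^sup>2 * V s\<bar>) / (2 * pi * sqrt \<mu>)"
proof -
  obtain w' w'' N where w': "\<And>x. (f has_real_derivative w' x) (at x)"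
    and w'': "\<And>R. w'' absolutely_integrable_on {0..R}"
    and int: "\<And>s. s \<ge> 0 \<Longrightarrow> w' s = w' 0 + integral {0..s} w''"
    and N: "negligible N" "\<And>s. s \<notin> N \<Longrightarrow> w'' s + 4 * pi\<^sup>2 * \<mu> * f s = 4 * pi\<^sup>2 * V s * f s"
    using eigenfunction_ode[OF eig] by metis
  have "deriv f 0 = w' 0" using w' by (rule DERIV_imp_deriv)
  then have odd': "odd n \<Longrightarrow> (\<forall>x. f (- x) = - f x) \<and> sgn (w' 0) = (-1) ^ (n div 2)" using odd by simp
  note main = cosine_main_term[OF w' \<open>\<mu> > 0\<close> even odd', simplified]
  define \<omega> where "\<omega> = 2 * pi * sqrt \<mu>"
  define A where "A = amplitude f \<mu>"
  have "\<omega> > 0" using \<open>\<mu> > 0\<close> by (simp add: \<omega>_def)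
  show Apos: "amplitude f \<mu> > 0" by (rule main(1))
  let ?L = "integral {0..R} (\<lambda>s. \<bar>4 * pi\<^sup>2 * V s\<bar>)"
  let ?m = "\<lambda>x. f 0 * cos (\<omega> * x) + w' 0 / \<omega> * sin (\<omega> * x)"
  have m: "?m x = A * cos (2 * pi * (sqrt \<mu> * x - real n / 4))" for x
    unfolding \<omega>_def A_def using main(2) by simp
  assume large: "4 * ?L \<le> 2 * pi * sqrt \<mu>" and x: "\<bar>x\<bar> \<le> R"
  have pos: "\<bar>f y - ?m y\<bar> \<le> 4 * ?L / \<omega> * A" if "y \<in> {0..R}" for y
  proof (rule large_frequency_bound[where w'' = w'' and N = N])
    show "w'' s + \<omega>\<^sup>2 * f s = 4 * pi\<^sup>2 * V s * f s" if "s \<notin> N" for s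
      using N(2)[OF that] \<open>\<mu> > 0\<close> by (simp add: \<omega>_def power_mult_distrib)
    show "(\<lambda>s. 4 * pi\<^sup>2 * V s) absolutely_integrable_on {0..R}"
      using V by (intro continuous_mult_absolutely_integrable continuous_intros) (auto simp: L1_loc_def)
    show "\<bar>?m s\<bar> \<le> A" for s
    proof -
      have "A * \<bar>cos (2 * pi * (sqrt \<mu> * s - real n / 4))\<bar> \<le> A * 1"
        using Apos by (intro mult_left_mono) (auto simp: A_def)
      then show ?thesis unfolding m using Apos by (simp add: abs_mult A_def)
    qed
    show "(f has_real_derivative w' s) (at s within {0..R})" for s
      by (rule has_field_derivative_at_within[OF w'])
    show "w' s = w' 0 + integral {0..s} w''" if "s \<in> {0..R}" for s
      using that by (intro int) simp
    show "4 * ?L \<le> \<omega>" using large by (simp only: \<omega>_def)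
  qed (fact \<open>\<omega> > 0\<close> w'' N(1) that)+
  \<comment> \<open>The coefficient of the wrong parity is zero, so the main term has the parity of
    \<open>f\<close> and negative arguments follow by reflection.\<close>
  have sym: "\<bar>f (- y) - ?m (- y)\<bar> = \<bar>f y - ?m y\<bar>" for y
  proof (cases "even n")
    case True
    then show ?thesis using main(3) even by simp
  next
    case False
    then have "f 0 = 0" "f (- y) = - f y" using main(3) odd by auto
    then show ?thesis by simp
  qed
  have "\<bar>f x - ?m x\<bar> \<le> 4 * ?L / \<omega> * A"
  proof (cases "x \<ge> 0")
    case True
    then show ?thesis using pos[of x] x by simp
  next
    case False
    then show ?thesis using pos[of "- x"] x sym[of x] by simp
  qed
  moreover have "\<bar>f x / A - cos (2 * pi * (sqrt \<mu> * x - real n / 4))\<bar> = \<bar>f x - ?m x\<bar> / A"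
    unfolding m using Apos by (simp add: A_def[symmetric] divide_simps abs_if mult_ac)
  ultimately show "\<bar>f x / amplitude f \<mu> - cos (2 * pi * (sqrt \<mu> * x - real n / 4))\<bar> \<le> 4 * ?L / (2 * pi * sqrt \<mu>)"
    using Apos by (simp add: A_def[symmetric] \<omega>_def[symmetric] divide_le_eq)
qed

section \<open>Sign correlations\<close>

lemma has_sign_correlation_cesaro_lim:
  "has_sign_correlation w x y l \<longleftrightarrow> cesaro_lim (\<lambda>n. of_bool (sgn (w n x) = sgn (w n y))) l"
proof -
  have "{..<N} \<inter> {n. sgn (w n x) = sgn (w n y)} = {n. n < N \<and> sgn (w n x) = sgn (w n y)}" for N by auto
  then show ?thesis
    by (simp add: has_sign_correlation_def cesaro_lim_def sum_of_bool_eq)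
qed

text \<open>Each parity class has density one half, so the result is the average of
  \<open>(1 + E) / 2\<close> and \<open>(1 + E') / 2\<close>. Within a class, the sign produced by
  the phase is the same at \<open>x\<close> and \<open>y\<close> and does not affect
  agreement.\<close>

lemma has_sign_correlation_cosine:
  fixes w r :: "nat \<Rightarrow> real \<Rightarrow> real" and \<mu> A :: "nat \<Rightarrow> real"
  assumes w: "\<forall>\<^sub>F n in sequentially. A n > 0 \<and> (\<forall>x. w n x = A n * (cos (2 * pi * (sqrt (\<mu> n) * x - real n / 4)) + r n x))"
    and r: "\<And>x. (\<lambda>n. r n x) \<longlonglongrightarrow> 0"
    and equi_even: "\<And>x. x \<noteq> 0 \<Longrightarrow> equidistributed_mod1 (\<lambda>n. sqrt (\<mu> (2 * n)) * x)"
    and equi_odd: "\<And>x. x \<noteq> 0 \<Longrightarrow> equidistributed_mod1 (\<lambda>n. sqrt (\<mu> (2 * n + 1)) * x)"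
    and xy: "x \<noteq> 0" "y \<noteq> 0" and E: "corr_lim x y 0 E" "corr_lim x y (1/4) E'"
  shows "has_sign_correlation w x y (1 / 2 + (E + E') / 4)"
proof -
  have sub: "cesaro_lim (\<lambda>m. of_bool (sgn (w (k m) x) = sgn (w (k m) y))) ((1 + E) / 2)"
    if k: "strict_mono k" and ph: "\<And>m t. cos (2 * pi * (t - real (k m) / 4)) = (-1) ^ m * cos (2 * pi * (t - \<theta>))"
      and \<theta>: "\<theta> = 0 \<or> \<theta> = 1 / 4" and equi: "\<And>x. x \<noteq> 0 \<Longrightarrow> equidistributed_mod1 (\<lambda>m. sqrt (\<mu> (k m)) * x)"
      and E: "corr_lim x y \<theta> E" for k \<theta> E
  proof -
    let ?s = "\<lambda>m. sqrt (\<mu> (k m))"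
    have "cesaro_lim (\<lambda>m. sqw (?s m * x - \<theta>) * sqw (?s m * y - \<theta>)) E"
      using E unfolding corr_lim_def by (auto intro: cesaro_lim_sqw[OF equi xy \<theta>])
    moreover have r': "(\<lambda>m. (-1) ^ m * r (k m) z) \<longlonglongrightarrow> 0" for z
    proof -
      have "(\<lambda>m. r (k m) z) \<longlonglongrightarrow> 0"
        using LIMSEQ_subseq_LIMSEQ[OF r k] by (simp add: o_def)
      then have "(\<lambda>m. \<bar>(-1) ^ m * r (k m) z\<bar>) \<longlonglongrightarrow> 0"
        by (simp add: abs_mult power_abs tendsto_rabs_zero)
      then show ?thesis by (rule tendsto_rabs_zero_cancel)
    qed
    ultimately have "cesaro_lim (\<lambda>m. of_bool
      (sgn (cos (2 * pi * (?s m * x - \<theta>)) + (-1) ^ m * r (k m) x) =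
       sgn (cos (2 * pi * (?s m * y - \<theta>)) + (-1) ^ m * r (k m) y))) ((1 + E) / 2)"
      by (intro sign_agreement equi xy)
    moreover have "\<forall>\<^sub>F m in sequentially. of_bool
      (sgn (cos (2 * pi * (?s m * x - \<theta>)) + (-1) ^ m * r (k m) x) =
       sgn (cos (2 * pi * (?s m * y - \<theta>)) + (-1) ^ m * r (k m) y)) =
       (of_bool (sgn (w (k m) x) = sgn (w (k m) y)) :: real)"
      using eventually_subseq[OF k w]
    proof eventually_elim
      case (elim m)
      \<comment> \<open>The power of -1 is pulled out of cosine and remainder together, so the
        remainder acquires it too; this keeps it a null sequence.\<close>
      have "sgn (w (k m) z) = (-1) ^ m * sgn (cos (2 * pi * (?s m * z - \<theta>)) + (-1) ^ m * r (k m) z)" for z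
      proof -
        have "w (k m) z = A (k m) * ((-1) ^ m * (cos (2 * pi * (?s m * z - \<theta>)) + (-1) ^ m * r (k m) z))"
        proof -
          have "w (k m) z = A (k m) * ((-1) ^ m * cos (2 * pi * (?s m * z - \<theta>)) + r (k m) z)"
            using elim by (simp only: ph)
          moreover have "(-1) ^ m * ((-1) ^ m * r (k m) z) = r (k m) z"
            by (simp add: mult.assoc[symmetric] flip: power_add mult_2)
          ultimately show ?thesis by (simp only: distrib_left)
        qed
        moreover have "sgn ((-1) ^ m * t) = (-1) ^ m * sgn t" for t :: real
          by (cases "even m") (simp_all add: sgn_minus)
        ultimately show ?thesis using elim by (simp only: sgn_mult[of "A (k m)"] sgn_pos mult_1)
      qed
      then show ?case by simp
    qed
    ultimately show ?thesis by (rule cesaro_lim_cong)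
  qed
  have "cesaro_lim (\<lambda>m. of_bool (sgn (w (2 * m) x) = sgn (w (2 * m) y))) ((1 + E) / 2)"
    by (rule sub[of _ 0]) (use cos_even_phase equi_even E in \<open>auto simp: strict_mono_def\<close>)
  moreover have "cesaro_lim (\<lambda>m. of_bool (sgn (w (2 * m + 1) x) = sgn (w (2 * m + 1) y))) ((1 + E') / 2)"
    by (rule sub[of _ "1/4"]) (use cos_odd_phase equi_odd E in \<open>auto simp: strict_mono_def\<close>)
  ultimately have "cesaro_lim (\<lambda>n. of_bool (sgn (w n x) = sgn (w n y))) (((1 + E) / 2 + (1 + E') / 2) / 2)"
    by (rule cesaro_lim_even_odd)
  moreover have "((1 + E) / 2 + (1 + E') / 2) / 2 = 1 / 2 + (E + E') / 4" by (simp add: field_simps)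
  ultimately show ?thesis by (simp add: has_sign_correlation_cesaro_lim)
qed

theorem theorem2:
  fixes V :: "real \<Rightarrow> real"
    and w :: "nat \<Rightarrow> real \<Rightarrow> real"
    and \<mu> :: "nat \<Rightarrow> real"
  assumes V_L1_loc: "V \<in> L1_loc"
    and V_even: "AE x in lebesgue. V (- x) = V x"
    and V_bounded_below: "ess_inf V > - \<infinity>"
    and V_at_infinity: "\<And>M. \<exists>R. AE x in lebesgue. \<bar>x\<bar> > R \<longrightarrow> V x \<ge> M"
    and basis: "L2_orthogonal_basis (\<lambda>n x. complex_of_real (w n x))"
    and eigen: "\<And>n. schroedinger_eigenfunction V (\<mu> n) (\<lambda>x. complex_of_real (w n x))"
    and eigenvalues: "filterlim \<mu> at_top sequentially"
    and w_even: "\<And>n x. even n \<Longrightarrow> w n (- x) = w n x"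
    and w_odd: "\<And>n x. odd n \<Longrightarrow> w n (- x) = - w n x"
    and equi_even: "\<And>x. x \<noteq> 0 \<Longrightarrow> equidistributed_mod1 (\<lambda>n. sqrt (\<mu> (2 * n)) * x)"
    and equi_odd: "\<And>x. x \<noteq> 0 \<Longrightarrow> equidistributed_mod1 (\<lambda>n. sqrt (\<mu> (2 * n + 1)) * x)"
    and sgn_even: "\<And>n. sgn (w (2 * n) 0) = (-1) ^ n"
    and sgn_odd: "\<And>n. sgn (deriv (w (2 * n + 1)) 0) = (-1) ^ n"
  shows "cosine_asymptotic w \<mu> \<and>
    (\<forall>(x::real) (y::real) (p::int) (q::int).
       x \<noteq> y \<longrightarrow> p \<noteq> 0 \<longrightarrow> q \<noteq> 0 \<longrightarrow> coprime p q \<longrightarrow> y \<noteq> 0 \<longrightarrow>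
       x / y = real_of_int p / real_of_int q \<longrightarrow>
       has_sign_correlation w x y
         (if ([p = 1] (mod 4) \<and> [q = 1] (mod 4)) \<or> ([p = 3] (mod 4) \<and> [q = 3] (mod 4))
          then 1 / 2 + 1 / (2 * real_of_int p * real_of_int q)
          else 1 / 2)) \<and>
    (\<forall>(x::real) (y::real). y \<noteq> 0 \<longrightarrow> x / y \<notin> \<rat> \<longrightarrow> has_sign_correlation w x y (1 / 2))"
proof -
  define A where "A n = amplitude (w n) (\<mu> n)" for n
  define c where "c n x = cos (2 * pi * (sqrt (\<mu> n) * x - real n / 4))" for n x
  \<comment> \<open>The asymptotic solved for its error. Its values at the finitely many indices
    with nonpositive eigenvalue are irrelevant to limits in \<open>n\<close>.\<close>
  define r where "r n x = w n x / A n - c n x" for n x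
  have even: "(\<forall>x. w n (- x) = w n x) \<and> sgn (w n 0) = (-1) ^ (n div 2)" if "even n" for n
    using that w_even sgn_even[of "n div 2"] by simp
  have odd: "(\<forall>x. w n (- x) = - w n x) \<and> sgn (deriv (w n) 0) = (-1) ^ (n div 2)" if "odd n" for n
    using that w_odd sgn_odd[of "n div 2"] by simp
  note rem = remainder_bound[OF V_L1_loc eigen _ even odd]
  have \<mu>_pos: "\<forall>\<^sub>F n in sequentially. \<mu> n > 0"
    using eigenvalues by (simp add: filterlim_at_top_dense)
  have w: "\<forall>\<^sub>F n in sequentially. A n > 0 \<and> (\<forall>x. w n x = A n * (cos (2 * pi * (sqrt (\<mu> n) * x - real n / 4)) + r n x))"
    using \<mu>_pos
  proof eventually_elim
    case (elim n)
    have "A n > 0" unfolding A_def by (rule rem(1)[OF elim])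
    then show ?case by (simp add: r_def c_def)
  qed
  have unif: "uniform_limit K r (\<lambda>x. 0) sequentially" if "compact K" for K :: "real set"
  proof -
    have "bounded K" using that by (rule compact_imp_bounded)
    then obtain R where R: "\<And>x. x \<in> K \<Longrightarrow> \<bar>x\<bar> \<le> R"
      by (auto simp: bounded_iff)
    define L where "L = integral {0..R} (\<lambda>s. \<bar>4 * pi\<^sup>2 * V s\<bar>)"
    have \<omega>: "filterlim (\<lambda>n. 2 * pi * sqrt (\<mu> n)) at_top sequentially"
      by (intro filterlim_tendsto_pos_mult_at_top[OF tendsto_const] filterlim_compose[OF sqrt_at_top] eigenvalues) simp
    show ?thesis
    proof (rule uniform_limitI)
      fix e :: real assume "e > 0"
      have "(\<lambda>n. 4 * L / (2 * pi * sqrt (\<mu> n))) \<longlonglongrightarrow> 0"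
        by (intro tendsto_divide_0[OF tendsto_const] filterlim_at_top_imp_at_infinity \<omega>)
      then have "\<forall>\<^sub>F n in sequentially. 4 * L / (2 * pi * sqrt (\<mu> n)) < e"
        using \<open>e > 0\<close> by (rule order_tendstoD(2))
      moreover have "\<forall>\<^sub>F n in sequentially. 4 * L \<le> 2 * pi * sqrt (\<mu> n)"
        using \<omega> by (simp only: filterlim_at_top)
      ultimately show "\<forall>\<^sub>F n in sequentially. \<forall>x\<in>K. dist (r n x) 0 < e"
        using \<mu>_pos
      proof eventually_elim
        case (elim n)
        show ?case
        proof
          fix x assume "x \<in> K"
          have "\<bar>r n x\<bar> \<le> 4 * L / (2 * pi * sqrt (\<mu> n))"
            unfolding r_def c_def A_def L_def
            by (rule rem(2)[OF elim(3) _ _ _ R[OF \<open>x \<in> K\<close>]]) (use elim(2) in \<open>simp_all add: L_def\<close>)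
          then show "dist (r n x) 0 < e" using elim(1) by simp
        qed
      qed
    qed
  qed
  have r0: "(\<lambda>n. r n x) \<longlonglongrightarrow> 0" for x
    using tendsto_uniform_limitI[OF unif[of "{x}"], of x] by simp
  have asym: "cosine_asymptotic w \<mu>"
    unfolding cosine_asymptotic_def
  proof (intro exI[of _ r] conjI allI impI)
    show "\<forall>\<^sub>F n in sequentially. \<forall>x. w n x =
       amplitude (w n) (\<mu> n) * (cos (2 * pi * (sqrt (\<mu> n) * x - real n / 4)) + r n x)"
      using w by eventually_elim (simp add: A_def)
  qed (rule unif)
  have corr: "has_sign_correlation w x y (1 / 2 + (E + E') / 4)"
    if "x \<noteq> 0" "y \<noteq> 0" "corr_lim x y 0 E" "corr_lim x y (1/4) E'" for x y E E'
    by (rule has_sign_correlation_cosine) (fact w r0 equi_even equi_odd that)+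
  have rational: "has_sign_correlation w x y
         (if ([p = 1] (mod 4) \<and> [q = 1] (mod 4)) \<or> ([p = 3] (mod 4) \<and> [q = 3] (mod 4))
          then 1 / 2 + 1 / (2 * real_of_int p * real_of_int q)
          else 1 / 2)"
    if pq: "p \<noteq> 0" "q \<noteq> 0" "coprime p q" "y \<noteq> 0" "x / y = real_of_int p / real_of_int q" for x y and p q :: int
  proof -
    obtain E E' where E: "corr_lim x y 0 E" "corr_lim x y (1/4) E'"
      and sum: "E + E' = (if odd p \<and> odd q \<and> 4 dvd (q - p) then 2 / (real_of_int p * real_of_int q) else 0)"
      using corr_lim_rational[OF \<open>y \<noteq> 0\<close> \<open>p \<noteq> 0\<close> \<open>q \<noteq> 0\<close> \<open>coprime p q\<close> pq(5)] by blast
    have "x \<noteq> 0" using pq by (metis divide_eq_0_iff of_int_eq_0_iff)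
    \<comment> \<open>The odd residues modulo 4 are 1 and 3, so the two listed cases say that
      \<open>p\<close> and \<open>q\<close> are odd and congruent modulo 4.\<close>
    have cond: "([p = 1] (mod 4) \<and> [q = 1] (mod 4)) \<or> ([p = 3] (mod 4) \<and> [q = 3] (mod 4)) \<longleftrightarrow>
      odd p \<and> odd q \<and> 4 dvd (q - p)"
    proof -
      have "odd i \<longleftrightarrow> i mod 4 = 1 \<or> i mod 4 = 3" for i :: int by presburger
      moreover have "4 dvd (q - p) \<longleftrightarrow> q mod 4 = p mod 4" by (rule mod_eq_dvd_iff[symmetric])
      moreover have "1 mod 4 = (1 :: int)" "3 mod 4 = (3 :: int)" by simp_all
      ultimately show ?thesis unfolding cong_def by metis
    qed
    \<comment> \<open>The summed limit 2/(pq) is divided by 4: one 2 comes from turning correlations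
      into indicators, the other from averaging over the parities.\<close>
    have "1 / 2 + (E + E') / 4 = (if odd p \<and> odd q \<and> 4 dvd (q - p)
       then 1 / 2 + 1 / (2 * real_of_int p * real_of_int q) else 1 / 2)"
      unfolding sum by simp
    then show ?thesis using corr[OF \<open>x \<noteq> 0\<close> \<open>y \<noteq> 0\<close> E] unfolding cond by (simp only:)
  qed
  have irrational: "has_sign_correlation w x y (1 / 2)" if "y \<noteq> 0" "x / y \<notin> \<rat>" for x y
  proof -
    have "x \<noteq> 0" using that(2) by (metis Rats_0 div_0)
    have "corr_lim x y \<theta> 0" for \<theta> by (rule corr_lim_0) (rule phase_corr_eq_0_irrational[OF that])
    from corr[OF \<open>x \<noteq> 0\<close> \<open>y \<noteq> 0\<close> this this] show ?thesis by simp
  qed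
  show ?thesis by (intro conjI allI impI asym rational irrational)
qed

end
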